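(* Let $\omega>0$, $\alpha\in\mathbb{R}$ with $\alpha\neq 0$, and $T=2\pi/\omega$. Let $f:\mathbb{R}\to\mathbb{R}$ be a $T$-periodic function which satisfies the Dirichlet conditions and has zero average, $\int_0^T f(t)\,dt=0$, with Fourier series $f(t)=\sum_{n=1}^{\infty}\bigl(a_n\cos(n\omega t)+b_n\sin(n\omega t)\bigr)$, where $a_1$ and $b_1$ are not both zero. Consider, for a small real parameter $\varepsilon$, the system $$\begin{cases} x' = y,\\ y' = -\omega^2 x+\varepsilon\bigl(f(t)-\alpha x^3-\cos(\omega t)\,x\bigr).\end{cases}$$ Then for sufficiently small $\varepsilon$ there exists an initial condition $x(0)=x_0^*$, $y(0)=y_0^*$ such that the system admits at least one $T$-periodic solution $(x(t,\varepsilon),y(t,\varepsilon))$ (with this initial condition), where $$(x_0^*,y_0^* )=\left(\sqrt[3]{\frac{4a_1^3}{3\alpha(a_1^2+b_1^2)}},\ \sqrt[3]{\frac{4b_1^3\omega^3}{3\alpha(a_1^2+b_1^2)}}\right).$$ Moreover, as $\varepsilon\to 0$, the solution satisfies $$(x(t,\varepsilon),y(t,\varepsilon))\to\left(\frac{\omega x_0^*\cos(\omega t)+y_0^*\sin(\omega t)}{\omega},\ -\omega x_0^*\sin(\omega t)+y_0^*\cos(\omega t)\right).$$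
   Context: A $T$-periodic function satisfies the Dirichlet conditions if on one period it is bounded, has at most finitely many discontinuities (all of them jump discontinuities), and has at most finitely many local maxima and minima; in particular its Fourier series converges. The coefficients are $a_n=\frac{2}{T}\int_0^T f(t)\cos(n\omega t)\,dt$ and $b_n=\frac{2}{T}\int_0^T f(t)\sin(n\omega t)\,dt$. Cube roots are real cube roots.
   Formalization: The initial condition of the periodic solution depends on ε and tends to (x0*, y0* ) as ε→0 (equal at ε=0), instead of being exactly (x0*, y0* ) for every small ε; the exact claim fails, e.g. for ω=α=1, f(t)=(3/4)cos t. *)

theory Defs
  imports "HOL-Analysis.Analysis" "HOL-Library.Periodic_Fun"
begin

definition jump_discontinuity :: "(real \<Rightarrow> real) \<Rightarrow> real \<Rightarrow> bool" where
  "jump_discontinuity f t \<longleftrightarrow>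
     (\<exists>l r. (f \<longlongrightarrow> l) (at_left t) \<and> (f \<longlongrightarrow> r) (at_right t) \<and> l \<noteq> r)"

(* The extrema are strict, so that piecewise constant waves (such as a square wave), all of
   whose plateau points are non-strict local extrema, are admitted. *)
definition strict_local_max :: "(real \<Rightarrow> real) \<Rightarrow> real \<Rightarrow> bool" where
  "strict_local_max f t \<longleftrightarrow> (\<forall>\<^sub>F s in at t. f s < f t)"

definition strict_local_min :: "(real \<Rightarrow> real) \<Rightarrow> real \<Rightarrow> bool" where
  "strict_local_min f t \<longleftrightarrow> (\<forall>\<^sub>F s in at t. f t < f s)"

(* For T-periodic f; continuity, jumps and extrema at the endpoint 0 of the period refer to f
   as a function on the whole line. *)
definition dirichlet_conditions :: "real \<Rightarrow> (real \<Rightarrow> real) \<Rightarrow> bool" where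
  "dirichlet_conditions T f \<longleftrightarrow>
     bounded (f ` {0..T}) \<and>
     finite {t \<in> {0..<T}. \<not> isCont f t} \<and>
     (\<forall>t\<in>{0..<T}. \<not> isCont f t \<longrightarrow> jump_discontinuity f t) \<and>
     finite {t \<in> {0..<T}. strict_local_max f t} \<and>
     finite {t \<in> {0..<T}. strict_local_min f t}"

definition fourier_cos :: "real \<Rightarrow> (real \<Rightarrow> real) \<Rightarrow> nat \<Rightarrow> real" where
  "fourier_cos T f n = 2 / T * integral {0..T} (\<lambda>t. f t * cos (real n * (2 * pi / T) * t))"

definition fourier_sin :: "real \<Rightarrow> (real \<Rightarrow> real) \<Rightarrow> nat \<Rightarrow> real" where
  "fourier_sin T f n = 2 / T * integral {0..T} (\<lambda>t. f t * sin (real n * (2 * pi / T) * t))"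

(* Global solutions of  x' = y,  y' = -omega^2 x + eps (f(t) - alpha x^3 - cos(omega t) x).
   At a jump of f no differentiable y can satisfy the second equation (for eps nonzero), since
   derivatives have no jump discontinuities.  It is therefore required exactly where f is
   continuous, together with continuity of y everywhere.  For f with locally finitely many
   discontinuities these are the Caratheodory solutions, and for continuous f the classical ones. *)
definition forced_osc_solution ::
  "real \<Rightarrow> real \<Rightarrow> (real \<Rightarrow> real) \<Rightarrow> real \<Rightarrow> (real \<Rightarrow> real) \<Rightarrow> (real \<Rightarrow> real) \<Rightarrow> bool" where
  "forced_osc_solution \<omega> \<alpha> f \<epsilon> x y \<longleftrightarrow>
     continuous_on UNIV y \<and>
     (\<forall>t. (x has_real_derivative y t) (at t)) \<and>
     (\<forall>t. isCont f t \<longrightarrow>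
        (y has_real_derivative
           - (\<omega>^2) * x t + \<epsilon> * (f t - \<alpha> * x t ^ 3 - cos (\<omega> * t) * x t)) (at t))"

end

theory Submission
  imports Defs
begin

text \<open>
  For \<open>\<epsilon> = 0\<close> every solution is \<open>T\<close>-periodic, and the task is to find out which of them survives the
  perturbation.  In the complex coordinate \<open>z = x + \<i> y / \<omega>\<close> the unperturbed flow is the rotation
  \<open>exp (- \<i> \<omega> t)\<close>; after undoing it, the amplitude \<open>u = z exp (\<i> \<omega> t)\<close> obeys \<open>u' = \<epsilon> H(t, u)\<close> with
  \<open>H\<close> periodic in \<open>t\<close>.  A periodic solution is, up to terms of order \<open>\<epsilon>\<close>, a constant \<open>c\<close>, and \<open>c\<close>
  must be a zero of the averaged field \<open>h(c) = \<integral> H(t, c) dt\<close> over a period.  Conversely, every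
  nondegenerate zero of \<open>h\<close> gives a periodic solution that is \<open>O(\<epsilon>)\<close>-close to it
  (\<open>periodic_averaging\<close>).  This is a Lyapunov--Schmidt reduction: the oscillating part of \<open>u\<close> and its
  constant part are determined by two coupled contractions, the second of which is a Newton iteration
  for \<open>h\<close> (\<open>coupled_contraction\<close>).

  Averaging keeps only the resonant terms (\<open>rotating_field_average\<close>): the forcing contributes its
  first Fourier coefficients \<open>\<beta> = a\<^sub>1 + \<i> b\<^sub>1\<close>, the cubic term contributes \<open>3 \<alpha> / 4 \<bar>c\<bar>\<^sup>2 c\<close>, and the
  parametric term \<open>cos (\<omega> t) x\<close> contributes nothing.  So \<open>h(c) = 0\<close> means \<open>3 \<alpha> / 4 \<bar>c\<bar>\<^sup>2 c = \<beta>\<close>, whose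
  only solution is \<open>c = x\<^sub>0 + \<i> y\<^sub>0 / \<omega>\<close>.  It is nonzero, and away from 0 the derivative of \<open>\<bar>c\<bar>\<^sup>2 c\<close> is
  invertible (\<open>cubic_newton\<close>), so the zero is nondegenerate.

  The forcing may jump, hence \<open>H\<close> is continuous in \<open>t\<close> only off a locally finite set.  Integrals of
  such functions exist, and their primitives are differentiable wherever the integrand is continuous;
  the equation \<open>x' = y\<close>, whose two sides are continuous, then holds at the jumps as well
  (\<open>has_real_derivative_extend\<close>).
\<close>

section \<open>Primitives of functions with locally finitely many discontinuities\<close>

text \<open>
  Off the finite exceptional set, which is negligible, the function is continuous and hence
  measurable, and a bounded measurable function is integrable.
\<close>
lemma integrable_bounded_finite_discontinuities:
  fixes f :: "real \<Rightarrow> 'a::euclidean_space"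
  assumes fin: "finite (D \<inter> {a..b})"
    and cont: "\<And>t. t \<notin> D \<Longrightarrow> isCont f t"
    and bound: "\<And>t. norm (f t) \<le> M"
  shows "f integrable_on {a..b}"
proof -
  let ?S = "{a..b} - D"
  have S: "?S = {a..b} - (D \<inter> {a..b})" by auto
  have meas: "?S \<in> sets lebesgue"
    unfolding S using fin by (intro sets.Diff) (auto simp: negligible_finite negligible_imp_sets)
  have "f integrable_on ?S"
  proof (rule measurable_bounded_by_integrable_imp_integrable)
    show "f \<in> borel_measurable (lebesgue_on ?S)"
      by (rule continuous_imp_measurable_on_sets_lebesgue[OF _ meas])
        (auto intro!: continuous_at_imp_continuous_on cont)
    have "(\<lambda>_. M) integrable_on {a..b}" by (simp add: integrable_const_ivl)
    then show "(\<lambda>_. M) integrable_on ?S"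
      by (rule integrable_spike_set)
        (rule negligible_subset[OF negligible_finite[OF fin]], auto)+
  qed (use bound meas in auto)
  then show ?thesis
    by (rule integrable_spike_set) (rule negligible_subset[OF negligible_finite[OF fin]], auto)+
qed

lemma integral_norm_bound_interval:
  fixes f :: "real \<Rightarrow> 'a::euclidean_space"
  assumes "f integrable_on {a..b}" "a \<le> b" "\<And>t. t \<in> {a..b} \<Longrightarrow> norm (f t) \<le> B" "0 \<le> B"
  shows "norm (integral {a..b} f) \<le> (b - a) * B"
  using has_integral_bound[of B f "integral {a..b} f" a b] assms
  by (auto simp: integrable_integral mult.commute)

text \<open>
  At every \<open>t\<close> at least one of the two integrals is over an empty or a one-point interval, so this
  is the integral from 0 to \<open>t\<close> with the usual sign convention for negative \<open>t\<close>.
\<close>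
definition primitive :: "(real \<Rightarrow> 'a::euclidean_space) \<Rightarrow> real \<Rightarrow> 'a" where
  "primitive f t = integral {0..t} f - integral {t..0} f"

lemma primitive_0 [simp]: "primitive f 0 = 0"
  by (simp add: primitive_def)

lemma primitive_nonneg: "0 \<le> t \<Longrightarrow> primitive f t = integral {0..t} f"
  by (cases "t = 0") (auto simp: primitive_def)

lemma primitive_split:
  assumes int: "\<And>a b. f integrable_on {a..b}" and "s \<le> t"
  shows "primitive f t = primitive f s + integral {s..t} f"
proof -
  have comb: "integral {a..c} f = integral {a..b} f + integral {b..c} f" if "a \<le> b" "b \<le> c" for a b c
    using Henstock_Kurzweil_Integration.integral_combine[OF that int] by simp
  have zero: "integral {a..b} f = 0" if "b \<le> a" for a b
    using that by (cases "a = b") auto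
  consider "0 \<le> s" | "s \<le> 0" "0 \<le> t" | "t \<le> 0" by linarith
  then show ?thesis
  proof cases
    case 1
    with comb[of 0 s t] \<open>s \<le> t\<close> zero[of 0 s] zero[of 0 t] show ?thesis
      by (simp add: primitive_def)
  next
    case 2
    with comb[of s 0 t] zero[of s 0] zero[of 0 t] show ?thesis
      by (simp add: primitive_def)
  next
    case 3
    with comb[of s t 0] \<open>s \<le> t\<close> zero[of s 0] zero[of t 0] show ?thesis
      by (simp add: primitive_def)
  qed
qed

lemma continuous_on_primitive:
  assumes int: "\<And>a b. f integrable_on {a..b}"
  shows "continuous_on UNIV (primitive f)"
proof (rule continuous_at_imp_continuous_on, rule ballI)
  fix t :: real
  have "continuous_on {t-1..t+1} (\<lambda>u. primitive f (t-1) + integral {t-1..u} f)"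
    by (intro continuous_intros indefinite_integral_continuous_1 int)
  then have "continuous_on {t-1..t+1} (primitive f)"
    by (rule continuous_on_eq) (rule primitive_split[OF int, symmetric], simp)
  then show "isCont (primitive f) t"
    by (rule continuous_on_interior) auto
qed

lemma primitive_has_vector_derivative:
  assumes int: "\<And>a b. f integrable_on {a..b}" and cont: "isCont f t"
  shows "(primitive f has_vector_derivative f t) (at t)"
proof -
  have "((\<lambda>u. integral {t-1..u} f) has_vector_derivative f t) (at t within ({t-1..t+1} - {}))"
    by (rule integral_has_vector_derivative_continuous_at[OF int])
      (simp_all add: continuous_at_imp_continuous_within cont)
  moreover have "at t within {t-1..t+1} = at t"
    by (rule at_within_interior) auto
  ultimately have "((\<lambda>u. integral {t-1..u} f) has_vector_derivative f t) (at t)"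
    by simp
  then have "((\<lambda>u. primitive f (t-1) + integral {t-1..u} f) has_vector_derivative f t) (at t)"
    by (auto intro!: derivative_eq_intros)
  then show ?thesis
    by (rule has_vector_derivative_transform_within_open[where S="{t-1<..<t+1}"])
      (auto intro!: primitive_split[OF int, symmetric])
qed

lemma primitive_diff:
  assumes "\<And>a b. f integrable_on {a..b}" "\<And>a b. g integrable_on {a..b}"
  shows "primitive (\<lambda>s. f s - g s) t = primitive f t - primitive g t"
  by (simp add: primitive_def Henstock_Kurzweil_Integration.integral_diff assms)

lemma primitive_add_period:
  assumes int: "\<And>a b. f integrable_on {a..b}" and per: "\<And>t. f (t + T) = f t"
  shows "primitive f (t + T) = primitive f t + primitive f T"
proof -
  have shift: "integral {a+T..b+T} f = integral {a..b} f" for a b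
    using integral_shift_real_ivl[of "a+T" T "b+T" f] by (simp add: per)
  show ?thesis
  proof (cases "0 \<le> t")
    case True
    with primitive_split[OF int, of T "t+T"] shift[of 0 t] show ?thesis
      by (simp add: primitive_nonneg)
  next
    case False
    with primitive_split[OF int, of "t+T" T] primitive_split[OF int, of "t" 0] shift[of t 0]
    show ?thesis by (simp add: algebra_simps)
  qed
qed

lemma periodic_reduce_to_period:
  fixes T :: real
  assumes T: "0 < T" and per: "\<And>t. f (t + T) = f t"
  obtains s n where "s \<in> {0..<T}" "t = s + of_int n * T" "f t = f s"
proof -
  interpret f: periodic_fun_simple f T by standard (rule per)
  define s where "s = frac (t / T) * T"
  have "t = (frac (t / T) + of_int \<lfloor>t / T\<rfloor>) * T"
    using T by (simp add: frac_def)
  then have t: "t = s + of_int \<lfloor>t / T\<rfloor> * T"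
    by (simp add: s_def distrib_right)
  have s: "s \<in> {0..<T}"
    using T frac_lt_1[of "t / T"] by (simp add: s_def)
  have "f t = f s"
    using f.plus_of_int[of s "\<lfloor>t / T\<rfloor>"] t by simp
  with s t show thesis by (rule that)
qed

text \<open>Having mean zero is what makes the primitive of a periodic function periodic.\<close>
lemma primitive_periodic:
  assumes "\<And>a b. f integrable_on {a..b}" "\<And>t. f (t + T) = f t" "0 \<le> T" "integral {0..T} f = 0"
  shows "primitive f (t + T) = primitive f t"
  using primitive_add_period[of f T t] assms by (simp add: primitive_nonneg)

lemma primitive_periodic_bound:
  assumes int: "\<And>a b. f integrable_on {a..b}" and per: "\<And>t. f (t + T) = f t" and T: "0 < T"
    and mean: "integral {0..T} f = 0" and bound: "\<And>t. norm (f t) \<le> B"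
  shows "norm (primitive f t) \<le> T * B"
proof -
  have B: "0 \<le> B" using bound[of 0] norm_ge_zero order_trans by blast
  obtain s where s: "s \<in> {0..<T}" "primitive f t = primitive f s"
    by (rule periodic_reduce_to_period[OF T, of "primitive f" t])
      (use primitive_periodic[OF int per _ mean] T in auto)
  have "norm (primitive f s) \<le> (s - 0) * B"
    using s B primitive_nonneg[of s f]
    by (simp only: atLeastLessThan_iff) (intro integral_norm_bound_interval int bound, auto)
  also have "\<dots> \<le> T * B" using s B by (intro mult_right_mono) auto
  finally show ?thesis using s by simp
qed

text \<open>
  By continuity \<open>x\<close> remains a primitive of \<open>y\<close> across the finitely many exceptional points of an
  interval, and a primitive of a continuous function is differentiable everywhere.
\<close>
lemma has_real_derivative_extend:
  fixes x y :: "real \<Rightarrow> real"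
  assumes fin: "\<And>a b. finite (D \<inter> {a..b})"
    and x: "continuous_on UNIV x" and y: "continuous_on UNIV y"
    and deriv: "\<And>t. t \<notin> D \<Longrightarrow> (x has_real_derivative y t) (at t)"
  shows "(x has_real_derivative y t) (at t)"
proof -
  have int: "y integrable_on {a..b}" for a b
    by (rule integrable_continuous_interval) (rule continuous_on_subset[OF y], simp)
  have x_eq: "x u = x (t-1) + integral {t-1..u} y" if "u \<in> {t-1..t+1}" for u
  proof -
    have "(y has_integral x u - x (t-1)) {t-1..u}"
    proof (rule fundamental_theorem_of_calculus_strong[OF fin[of "t-1" u]])
      show "(x has_vector_derivative y s) (at s)" if "s \<in> {t-1..u} - D \<inter> {t-1..u}" for s
        using deriv[of s] that by (auto simp: has_real_derivative_iff_has_vector_derivative)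
      show "t - 1 \<le> u" using that by simp
      show "continuous_on {t-1..u} x" by (rule continuous_on_subset[OF x]) simp
    qed
    then show ?thesis by (simp add: integral_unique)
  qed
  have x_rep: "x (t-1) - primitive y (t-1) + primitive y u = x u" if "u \<in> {t-1<..<t+1}" for u
    using x_eq[of u] primitive_split[OF int, of "t-1" u] that by simp
  have "(primitive y has_vector_derivative y t) (at t)"
    using y by (intro primitive_has_vector_derivative int) (simp add: continuous_on_eq_continuous_at)
  then have "((\<lambda>u. x (t-1) - primitive y (t-1) + primitive y u) has_vector_derivative y t) (at t)"
    by (auto intro!: derivative_eq_intros)
  then have "(x has_vector_derivative y t) (at t)"
    by (rule has_vector_derivative_transform_within_open[where S="{t-1<..<t+1}"])
      (auto simp: x_rep)
  then show ?thesis by (simp add: has_real_derivative_iff_has_vector_derivative)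
qed

section \<open>A coupled contraction principle\<close>

text \<open>
  The Lyapunov--Schmidt scheme in metric form.  For fixed \<open>x\<close> the equation \<open>G x y = y\<close> is solved by
  contraction, and its solution \<open>h x\<close> is \<open>2m\<close>-Lipschitz in \<open>x\<close>; substituting it into the other
  equation leaves the self-map \<open>x \<mapsto> F x (h x)\<close>, which is again a contraction.  The constant \<open>l\<close>
  may be large: only its product with \<open>m\<close> has to be small.
\<close>
lemma coupled_contraction:
  fixes F :: "'a::metric_space \<Rightarrow> 'b::metric_space \<Rightarrow> 'a" and G :: "'a \<Rightarrow> 'b \<Rightarrow> 'b"
  assumes X: "complete X" "X \<noteq> {}" and Y: "complete Y" "Y \<noteq> {}"
    and F: "\<And>x y. x \<in> X \<Longrightarrow> y \<in> Y \<Longrightarrow> F x y \<in> X"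
    and G: "\<And>x y. x \<in> X \<Longrightarrow> y \<in> Y \<Longrightarrow> G x y \<in> Y"
    and F_lip: "\<And>x y x' y'. x \<in> X \<Longrightarrow> y \<in> Y \<Longrightarrow> x' \<in> X \<Longrightarrow> y' \<in> Y \<Longrightarrow>
      dist (F x y) (F x' y') \<le> k * dist x x' + l * dist y y'"
    and G_lip: "\<And>x y x' y'. x \<in> X \<Longrightarrow> y \<in> Y \<Longrightarrow> x' \<in> X \<Longrightarrow> y' \<in> Y \<Longrightarrow>
      dist (G x y) (G x' y') \<le> m * (dist x x' + dist y y')"
    and k: "0 \<le> k" and l: "0 \<le> l" and m: "0 \<le> m" "m \<le> 1/2" and small: "k + 2 * l * m < 1"
  shows "\<exists>x\<in>X. \<exists>y\<in>Y. F x y = x \<and> G x y = y"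
proof -
  have "\<exists>y\<in>Y. G x y = y" if "x \<in> X" for x
  proof -
    have "\<exists>!y\<in>Y. G x y = y"
    proof (rule Banach_fix[OF Y])
      show "dist (G x y) (G x y') \<le> m * dist y y'" if "y \<in> Y" "y' \<in> Y" for y y'
        using G_lip[of x y x y'] that \<open>x \<in> X\<close> by simp
    qed (use that m G in auto)
    then show ?thesis by blast
  qed
  then obtain h where h: "\<And>x. x \<in> X \<Longrightarrow> h x \<in> Y" "\<And>x. x \<in> X \<Longrightarrow> G x (h x) = h x"
    by metis
  have h_lip: "dist (h x) (h x') \<le> 2 * m * dist x x'" if "x \<in> X" "x' \<in> X" for x x'
  proof -
    have "dist (h x) (h x') \<le> m * dist x x' + m * dist (h x) (h x')"
      using G_lip[of x "h x" x' "h x'"] that h by (simp add: algebra_simps)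
    also have "\<dots> \<le> m * dist x x' + 1/2 * dist (h x) (h x')"
      using m by (intro add_left_mono mult_right_mono) auto
    finally show ?thesis by simp
  qed
  have "\<exists>!x\<in>X. F x (h x) = x"
  proof (rule Banach_fix[OF X, of "k + 2 * l * m"])
    fix x x' assume xx: "x \<in> X" "x' \<in> X"
    have "dist (F x (h x)) (F x' (h x')) \<le> k * dist x x' + l * dist (h x) (h x')"
      using F_lip xx h by blast
    also have "\<dots> \<le> k * dist x x' + l * (2 * m * dist x x')"
      using h_lip[OF xx] l by (intro add_left_mono mult_left_mono) auto
    finally show "dist (F x (h x)) (F x' (h x')) \<le> (k + 2 * l * m) * dist x x'"
      by (simp add: algebra_simps)
  next
    show "0 \<le> k + 2 * l * m" using k l m by simp
    show "k + 2 * l * m < 1" by (rule small)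
    show "(\<lambda>x. F x (h x)) ` X \<subseteq> X" using F h(1) by blast
  qed
  then show ?thesis using h by blast
qed

section \<open>Averaging near a nondegenerate zero\<close>

lemma eventually_mult_abs_less:
  fixes a d :: real
  assumes "0 < d"
  shows "\<forall>\<^sub>F e in nhds 0. \<bar>e\<bar> * a < d"
proof -
  have "((\<lambda>e. \<bar>e\<bar> * a) \<longlongrightarrow> 0) (nhds 0)"
    by (rule tendsto_eq_rhs[OF tendsto_mult[OF tendsto_rabs[OF filterlim_ident] tendsto_const]]) simp
  then show ?thesis by (rule order_tendstoD) (rule assms)
qed

text \<open>
  Write a periodic solution of \<open>u' = \<epsilon> H(t, u)\<close> as \<open>u = c' + w\<close> with a constant \<open>c'\<close> and a small
  periodic function \<open>w\<close> that vanishes at 0.  For any periodic \<open>u\<close> let \<open>J\<close> be the integral of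
  \<open>H(s, u(s))\<close> over a period.  The function \<open>\<epsilon> (H(s, u(s)) - J / T)\<close> has mean zero, so its primitive
  is periodic, and \<open>u\<close> is a solution as soon as \<open>w\<close> equals this primitive and \<open>J = 0\<close>.  The second
  condition is replaced by the fixed point equation \<open>c' = c' - N J\<close>, in which the injective linear
  map \<open>N\<close> is an approximate inverse of the derivative of the averaged field \<open>h\<close> at its zero \<open>c\<close>;
  assumption \<open>newton\<close> says that the resulting Newton step contracts.  The map for \<open>w\<close> carries the
  factor \<open>\<epsilon>\<close>, so that the two equations have the form required by \<open>coupled_contraction\<close>.

  Assumption \<open>lip2\<close> bounds a second difference, as holds for twice differentiable \<open>H\<close>.  It makes the
  Newton step a contraction in \<open>c'\<close> also when \<open>w\<close> is present, since the change of \<open>J\<close> with \<open>c'\<close> then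
  differs from that of \<open>h\<close> only by a multiple of the size of \<open>w\<close>.
\<close>
theorem periodic_averaging:
  fixes H :: "real \<Rightarrow> 'a::euclidean_space \<Rightarrow> 'a" and N :: "'a \<Rightarrow> 'a"
    and T r k L L2 M :: real and c :: 'a
  assumes h_def: "\<And>u. h u = integral {0..T} (\<lambda>t. H t u)"
    and T: "0 < T" and r: "0 < r"
    and per: "\<And>t u. H (t + T) u = H t u"
    and fin: "\<And>a b. finite (D \<inter> {a..b})"
    and cont: "\<And>v t. t \<notin> D \<Longrightarrow> isCont v t \<Longrightarrow> isCont (\<lambda>s. H s (v s)) t"
    and bound: "\<And>t u. u \<in> cball c r \<Longrightarrow> norm (H t u) \<le> M"
    and lip: "\<And>t u v. u \<in> cball c r \<Longrightarrow> v \<in> cball c r \<Longrightarrow>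
      norm (H t u - H t v) \<le> L * norm (u - v)"
    and lip2: "\<And>t u v w. u \<in> cball c r \<Longrightarrow> v \<in> cball c r \<Longrightarrow>
      u + w \<in> cball c r \<Longrightarrow> v + w \<in> cball c r \<Longrightarrow>
      norm ((H t (u + w) - H t u) - (H t (v + w) - H t v)) \<le> L2 * norm w * norm (u - v)"
    and nonneg: "0 \<le> L" "0 \<le> L2" "0 \<le> M"
    and zero: "h c = 0"
    and N: "bounded_linear N" "\<And>v. N v = 0 \<Longrightarrow> v = 0"
    and k: "0 \<le> k" "k < 1"
    and newton: "\<And>u v. u \<in> cball c r \<Longrightarrow> v \<in> cball c r \<Longrightarrow>
      norm (u - v - N (h u - h v)) \<le> k * norm (u - v)"
  shows "\<exists>\<epsilon>\<^sub>0>0. \<exists>C. \<forall>\<epsilon>. \<bar>\<epsilon>\<bar> < \<epsilon>\<^sub>0 \<longrightarrow>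
    (\<exists>u. continuous_on UNIV u \<and> (\<forall>t. u (t + T) = u t) \<and>
      (\<forall>t. t \<notin> D \<longrightarrow> (u has_vector_derivative \<epsilon> *\<^sub>R H t (u t)) (at t)) \<and>
      (\<forall>t. norm (u t - c) \<le> C * \<bar>\<epsilon>\<bar>))"
proof -
  interpret N: bounded_linear N by (rule N)
  obtain n where n: "0 < n" "\<And>v. norm (N v) \<le> norm v * n"
    using N.pos_bounded by blast
  \<comment> \<open>The Newton step contracts with constant \<open>k\<close> at \<open>w = 0\<close>; half of the gap to 1 is kept
    for the perturbation by \<open>w\<close>, the other half for the coupling of the two equations.\<close>
  define k' where "k' = (1 + k) / 2"
  define l where "l = n * T * L"
  have k': "0 \<le> k'" "k' < 1" and l: "0 \<le> l"
    using k n T nonneg by (auto simp: k'_def l_def)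
  obtain \<rho> where \<rho>: "0 < \<rho>" "\<rho> \<le> r / 2" "\<rho> * (n * T * L2) \<le> (1 - k) / 2" "\<rho> * l \<le> (1 - k') * (r / 2)"
  proof -
    have "\<forall>\<^sub>F e in nhds (0::real). \<bar>e\<bar> * 1 < r / 2 \<and> \<bar>e\<bar> * (n * T * L2) < (1 - k) / 2 \<and>
        \<bar>e\<bar> * l < (1 - k') * (r / 2)"
      using r k k' by (intro eventually_conj eventually_mult_abs_less) auto
    then obtain d where d: "0 < d" "\<And>e. dist e 0 < d \<Longrightarrow> \<bar>e\<bar> * 1 < r / 2 \<and>
        \<bar>e\<bar> * (n * T * L2) < (1 - k) / 2 \<and> \<bar>e\<bar> * l < (1 - k') * (r / 2)"
      unfolding eventually_nhds_metric by blast
    from d(1) d(2)[of "d/2"] show thesis by (intro that[of "d/2"]) auto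
  qed
  have "\<forall>\<^sub>F e in nhds (0::real). \<bar>e\<bar> * (T * (2 * M)) < \<rho> \<and> \<bar>e\<bar> * (2 * T * L) < 1 / 2 \<and>
      \<bar>e\<bar> * (2 * l * (2 * T * L)) < 1 - k'"
    using \<rho> k' by (intro eventually_conj eventually_mult_abs_less) auto
  then obtain \<epsilon>\<^sub>0 where \<epsilon>\<^sub>0: "0 < \<epsilon>\<^sub>0"
    "\<And>e. \<bar>e\<bar> < \<epsilon>\<^sub>0 \<Longrightarrow> \<bar>e\<bar> * (T * (2 * M)) < \<rho> \<and> \<bar>e\<bar> * (2 * T * L) < 1 / 2 \<and>
      \<bar>e\<bar> * (2 * l * (2 * T * L)) < 1 - k'"
    unfolding eventually_nhds_metric by (auto simp: dist_real_def)

  \<comment> \<open>Half of the radius is left for each of the constant part and the oscillating part.\<close>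
  define X where "X = cball c (r / 2)"
  define Y where "Y = {w :: real \<Rightarrow>\<^sub>C 'a. (\<forall>t. apply_bcontfun w (t + T) = apply_bcontfun w t) \<and> norm w \<le> \<rho>}"
  define f where "f c' w s = H s (c' + apply_bcontfun w s)" for c' and w :: "real \<Rightarrow>\<^sub>C 'a" and s
  define J where "J c' w = integral {0..T} (f c' w)" for c' w
  define g where "g c' w s = f c' w s - (1 / T) *\<^sub>R J c' w" for c' w s

  have X: "complete X" "X \<noteq> {}" "c \<in> X"
    using r by (auto simp: X_def complete_eq_closed)
  have Y0: "0 \<in> Y" using \<rho> by (simp add: Y_def)
  have "closed Y"
    unfolding closed_sequential_limits
  proof safe
    fix w W assume w: "\<forall>i. w i \<in> Y" and lim: "w \<longlonglongrightarrow> W"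
    have pw: "(\<lambda>i. w i t) \<longlonglongrightarrow> W t" for t
      using tendsto_uniform_limitI[OF tendsto_bcontfun_uniform_limit[OF lim]] by simp
    have "W (t + T) = W t" for t
      using pw[of "t + T"] pw[of t] w by (intro LIMSEQ_unique[OF pw[of "t+T"]]) (simp add: Y_def)
    moreover have "norm W \<le> \<rho>"
      using w by (intro LIMSEQ_le_const2[OF tendsto_norm[OF lim]]) (auto simp: Y_def)
    ultimately show "W \<in> Y" by (simp add: Y_def)
  qed
  then have Y: "complete Y" "Y \<noteq> {}" using Y0 by (auto simp: complete_eq_closed)

  have w_le: "norm (apply_bcontfun w s) \<le> \<rho>" if "w \<in> Y" for w s
    using norm_bounded[of w s] that by (simp add: Y_def)
  have X_ball: "c' \<in> cball c r" if "c' \<in> X" for c'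
    using that r by (auto simp: X_def)
  have ball: "c' + apply_bcontfun w s \<in> cball c r" if "c' \<in> X" "w \<in> Y" for c' w s
  proof -
    have "norm (c' - c + w s) \<le> r / 2 + r / 2"
      using that w_le[of w s] \<rho> by (intro norm_triangle_le) (auto simp: X_def dist_norm norm_minus_commute)
    then show ?thesis by (simp add: dist_norm norm_minus_commute algebra_simps)
  qed
  have f_cont: "isCont (f c' w) t" if "t \<notin> D" for c' w t
    unfolding f_def
    by (intro cont that continuous_intros continuous_on_interior[OF continuous_on_apply_bcontfun[of UNIV]]) auto
  have f_bound: "norm (f c' w s) \<le> M" if "c' \<in> X" "w \<in> Y" for c' w s
    unfolding f_def by (intro bound ball that)
  have f_int: "f c' w integrable_on {a..b}" if "c' \<in> X" "w \<in> Y" for c' w a b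
    by (rule integrable_bounded_finite_discontinuities[OF fin f_cont f_bound[OF that]])
  have J_bound: "norm (J c' w) \<le> T * M" if "c' \<in> X" "w \<in> Y" for c' w
    unfolding J_def using integral_norm_bound_interval[OF f_int[OF that] _ f_bound[OF that], of 0 T] T nonneg
    by simp
  have f_lip: "norm (f c1 w1 s - f c2 w2 s) \<le> L * (norm (c1 - c2) + norm (w1 - w2))"
    if "c1 \<in> X" "w1 \<in> Y" "c2 \<in> X" "w2 \<in> Y" for c1 w1 c2 w2 s
  proof -
    have "norm (f c1 w1 s - f c2 w2 s) \<le> L * norm ((c1 - c2) + (w1 s - w2 s))"
      using lip[OF ball[OF that(1,2), of s] ball[OF that(3,4), of s], of s] by (simp add: f_def algebra_simps)
    also have "norm ((c1 - c2) + (w1 s - w2 s)) \<le> norm (c1 - c2) + norm (w1 - w2)"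
      using norm_bounded[of "w1 - w2" s] by (intro norm_triangle_le) simp
    finally show ?thesis using nonneg by (simp add: mult_left_mono)
  qed
  have J_lip: "norm (J c1 w1 - J c2 w2) \<le> T * (L * (norm (c1 - c2) + norm (w1 - w2)))"
    if "c1 \<in> X" "w1 \<in> Y" "c2 \<in> X" "w2 \<in> Y" for c1 w1 c2 w2
  proof -
    have "J c1 w1 - J c2 w2 = integral {0..T} (\<lambda>s. f c1 w1 s - f c2 w2 s)"
      unfolding J_def by (rule Henstock_Kurzweil_Integration.integral_diff[symmetric]) (intro f_int that)+
    also have "norm \<dots> \<le> (T - 0) * (L * (norm (c1 - c2) + norm (w1 - w2)))"
      by (intro integral_norm_bound_interval Henstock_Kurzweil_Integration.integrable_diff f_int f_lip that)
        (use T nonneg in auto)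
    finally show ?thesis by simp
  qed
  have J_0: "J c' 0 = h c'" for c'
    by (simp add: J_def h_def f_def[abs_def])
  have J_lip2: "norm ((J c1 w - h c1) - (J c2 w - h c2)) \<le> T * (L2 * \<rho> * norm (c1 - c2))"
    if "c1 \<in> X" "c2 \<in> X" "w \<in> Y" for c1 c2 w
  proof -
    have "(J c1 w - h c1) - (J c2 w - h c2) =
        integral {0..T} (\<lambda>s. (f c1 w s - f c1 0 s) - (f c2 w s - f c2 0 s))"
      unfolding J_0[symmetric] J_def using that Y0
      by (simp add: Henstock_Kurzweil_Integration.integral_diff
          Henstock_Kurzweil_Integration.integrable_diff f_int)
    also have "norm \<dots> \<le> (T - 0) * (L2 * \<rho> * norm (c1 - c2))"
    proof (intro integral_norm_bound_interval Henstock_Kurzweil_Integration.integrable_diff f_int that Y0)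
      fix s
      have "norm ((f c1 w s - f c1 0 s) - (f c2 w s - f c2 0 s)) \<le> L2 * norm (w s) * norm (c1 - c2)"
        using lip2[OF X_ball[OF that(1)] X_ball[OF that(2)] ball[OF that(1,3)] ball[OF that(2,3)]]
        by (simp add: f_def)
      also have "\<dots> \<le> L2 * \<rho> * norm (c1 - c2)"
        using nonneg w_le[OF that(3)] by (intro mult_right_mono mult_left_mono) auto
      finally show "norm ((f c1 w s - f c1 0 s) - (f c2 w s - f c2 0 s)) \<le> L2 * \<rho> * norm (c1 - c2)" .
    qed (use T nonneg \<rho> in auto)
    finally show ?thesis by simp
  qed
  have f_per: "f c' w (t + T) = f c' w t" if "w \<in> Y" for c' w t
    using that by (simp add: f_def per Y_def)
  have g_int: "g c' w integrable_on {a..b}" if "c' \<in> X" "w \<in> Y" for c' w a b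
    unfolding g_def by (intro Henstock_Kurzweil_Integration.integrable_diff f_int that integrable_const_ivl)
  have g_mean: "integral {0..T} (g c' w) = 0" if "c' \<in> X" "w \<in> Y" for c' w
    unfolding g_def using T that
    by (subst Henstock_Kurzweil_Integration.integral_diff)
      (auto intro!: f_int integrable_const_ivl simp: J_def)
  have g_per: "g c' w (t + T) = g c' w t" if "w \<in> Y" for c' w t
    using that by (simp add: g_def f_per)
  have T_scale: "norm ((1 / T) *\<^sub>R v) \<le> B" if "norm v \<le> T * B" for v :: 'a and B
    using that T by (simp add: field_simps)
  have g_bound: "norm (g c' w s) \<le> 2 * M" if "c' \<in> X" "w \<in> Y" for c' w s
    using norm_triangle_ineq4[of "f c' w s" "(1 / T) *\<^sub>R J c' w"] f_bound[OF that, of s]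
      T_scale[OF J_bound[OF that]]
    by (simp add: g_def)
  have prim_bound: "norm (primitive (g c' w) t) \<le> T * (2 * M)" if "c' \<in> X" "w \<in> Y" for c' w t
    by (intro primitive_periodic_bound g_int g_per g_mean g_bound T that)
  have prim_lip: "norm (primitive (g c1 w1) t - primitive (g c2 w2) t)
      \<le> T * (2 * (L * (norm (c1 - c2) + norm (w1 - w2))))"
    if "c1 \<in> X" "w1 \<in> Y" "c2 \<in> X" "w2 \<in> Y" for c1 w1 c2 w2 t
  proof -
    let ?B = "L * (norm (c1 - c2) + norm (w1 - w2))"
    have "norm (g c1 w1 s - g c2 w2 s) \<le> 2 * ?B" for s
    proof -
      have eq: "g c1 w1 s - g c2 w2 s = (f c1 w1 s - f c2 w2 s) - (1 / T) *\<^sub>R (J c1 w1 - J c2 w2)"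
        by (simp add: g_def algebra_simps)
      show ?thesis
        unfolding eq
        using norm_triangle_ineq4[of "f c1 w1 s - f c2 w2 s" "(1 / T) *\<^sub>R (J c1 w1 - J c2 w2)"]
          f_lip[OF that, of s] T_scale[OF J_lip[OF that]] by linarith
    qed
    then have "norm (primitive (\<lambda>s. g c1 w1 s - g c2 w2 s) t) \<le> T * (2 * ?B)"
      using that T by (intro primitive_periodic_bound Henstock_Kurzweil_Integration.integrable_diff)
        (simp_all add: g_int g_per g_mean Henstock_Kurzweil_Integration.integral_diff)
    then show ?thesis using that by (simp add: primitive_diff g_int)
  qed

  define F where "F c' w = c' - N (J c' w)" for c' w
  have F_lip: "norm (F c1 w1 - F c2 w2) \<le> k' * norm (c1 - c2) + l * norm (w1 - w2)"
    if "c1 \<in> X" "w1 \<in> Y" "c2 \<in> X" "w2 \<in> Y" for c1 w1 c2 w2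
  proof -
    \<comment> \<open>\<open>?a\<close> is the Newton step for the averaged field, \<open>?b\<close> the error caused by a common \<open>w1\<close>,
      which is of second order, and \<open>?c\<close> the effect of changing \<open>w\<close>.\<close>
    let ?a = "c1 - c2 - N (h c1 - h c2)"
    let ?b = "N ((J c1 w1 - h c1) - (J c2 w1 - h c2))"
    let ?c = "N (J c2 w1 - J c2 w2)"
    have "F c1 w1 - F c2 w2 = ?a - ?b - ?c"
      by (simp add: F_def N.diff)
    then have "norm (F c1 w1 - F c2 w2) \<le> norm ?a + norm ?b + norm ?c"
      using norm_triangle_ineq4[of "?a - ?b" ?c] norm_triangle_ineq4[of ?a ?b] by simp
    moreover have "norm ?a \<le> k * norm (c1 - c2)"
      by (intro newton X_ball that)
    moreover have "norm ?b \<le> (1 - k) / 2 * norm (c1 - c2)"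
    proof -
      have "norm ?b \<le> T * (L2 * \<rho> * norm (c1 - c2)) * n"
        using n(2) J_lip2[OF that(1,3,2)] n(1) by (meson mult_right_mono less_imp_le order_trans)
      also have "\<dots> = \<rho> * (n * T * L2) * norm (c1 - c2)" by simp
      also have "\<dots> \<le> (1 - k) / 2 * norm (c1 - c2)" using \<rho> by (intro mult_right_mono) auto
      finally show ?thesis .
    qed
    moreover have "norm ?c \<le> l * norm (w1 - w2)"
    proof -
      have "norm ?c \<le> T * (L * norm (w1 - w2)) * n"
        using n(2)[of "J c2 w1 - J c2 w2"] J_lip[OF that(3,2,3,4)] n(1)
        by (smt (verit) mult_right_mono diff_self norm_zero)
      then show ?thesis by (simp add: l_def mult_ac)
    qed
    ultimately have "norm (F c1 w1 - F c2 w2) \<le>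
        k * norm (c1 - c2) + (1 - k) / 2 * norm (c1 - c2) + l * norm (w1 - w2)" by linarith
    then show ?thesis by (simp add: k'_def field_simps)
  qed
  have F_c: "F c 0 = c" by (simp add: F_def J_0 zero N.zero)
  have F_X: "F c' w \<in> X" if "c' \<in> X" "w \<in> Y" for c' w
  proof -
    have "norm (F c' w - c) \<le> k' * norm (c' - c) + l * norm w"
      using F_lip[OF that X(3) Y0] by (simp add: F_c)
    also have "\<dots> \<le> k' * (r / 2) + l * \<rho>"
      using that k' l by (intro add_mono mult_left_mono) (auto simp: X_def Y_def dist_norm norm_minus_commute)
    also have "\<dots> \<le> r / 2" using \<rho>(4) by (simp add: algebra_simps)
    finally show ?thesis by (simp add: X_def dist_norm norm_minus_commute)
  qed

  define C where "C = l * (T * (2 * M)) / (1 - k') + T * (2 * M)"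
  show ?thesis
  proof (rule exI[of _ \<epsilon>\<^sub>0], rule conjI[OF \<epsilon>\<^sub>0(1)], rule exI[of _ C], intro allI impI)
    fix \<epsilon> assume "\<bar>\<epsilon>\<bar> < \<epsilon>\<^sub>0"
    note small = \<epsilon>\<^sub>0(2)[OF this]
    define G where "G c' w = Bcontfun (\<lambda>t. \<epsilon> *\<^sub>R primitive (g c' w) t)" for c' w
    have G_norm: "norm (\<epsilon> *\<^sub>R primitive (g c' w) t) \<le> \<bar>\<epsilon>\<bar> * (T * (2 * M))" if "c' \<in> X" "w \<in> Y" for c' w t
      using prim_bound[OF that, of t] by (simp add: mult_left_mono)
    have G_apply: "apply_bcontfun (G c' w) t = \<epsilon> *\<^sub>R primitive (g c' w) t" if "c' \<in> X" "w \<in> Y" for c' w t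
      unfolding G_def
      by (subst Bcontfun_inverse)
        (auto intro!: bcontfun_normI[OF _ G_norm[OF that]] continuous_intros continuous_on_primitive g_int that)
    have G_le: "norm (G c' w) \<le> \<bar>\<epsilon>\<bar> * (T * (2 * M))" if "c' \<in> X" "w \<in> Y" for c' w
      by (rule norm_bound) (simp only: G_apply[OF that] G_norm[OF that])
    have G_Y: "G c' w \<in> Y" if "c' \<in> X" "w \<in> Y" for c' w
      using G_le[OF that] small that T
      by (auto simp: Y_def G_apply primitive_periodic[OF g_int g_per _ g_mean])
    have G_lip: "norm (G c1 w1 - G c2 w2) \<le> \<bar>\<epsilon>\<bar> * (2 * T * L) * (norm (c1 - c2) + norm (w1 - w2))"
      if "c1 \<in> X" "w1 \<in> Y" "c2 \<in> X" "w2 \<in> Y" for c1 w1 c2 w2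
    proof (rule norm_bound)
      fix t
      have "norm ((G c1 w1 - G c2 w2) t) = \<bar>\<epsilon>\<bar> * norm (primitive (g c1 w1) t - primitive (g c2 w2) t)"
        using that by (simp add: G_apply flip: scaleR_diff_right)
      also have "\<dots> \<le> \<bar>\<epsilon>\<bar> * (T * (2 * (L * (norm (c1 - c2) + norm (w1 - w2)))))"
        by (intro mult_left_mono prim_lip that) auto
      finally show "norm ((G c1 w1 - G c2 w2) t) \<le> \<bar>\<epsilon>\<bar> * (2 * T * L) * (norm (c1 - c2) + norm (w1 - w2))"
        by (simp add: mult_ac)
    qed
    have "\<exists>c'\<in>X. \<exists>w\<in>Y. F c' w = c' \<and> G c' w = w"
      by (rule coupled_contraction[OF X(1,2) Y F_X G_Y, where k=k' and l=l and m="\<bar>\<epsilon>\<bar> * (2 * T * L)"])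
        (use F_lip G_lip k' l small T nonneg in \<open>auto simp: dist_norm mult_ac\<close>)
    then obtain c' w where cw: "c' \<in> X" "w \<in> Y" "F c' w = c'" "G c' w = w" by blast
    have J0: "J c' w = 0" using cw(3) N(2) by (simp add: F_def)
    have w_eq: "w t = \<epsilon> *\<^sub>R primitive (f c' w) t" for t
      using G_apply[OF cw(1,2), of t] cw(4) J0 by (simp add: g_def[abs_def])
    have w_small: "norm w \<le> \<bar>\<epsilon>\<bar> * (T * (2 * M))" using G_le[OF cw(1,2)] cw(4) by simp
    \<comment> \<open>Comparison with the fixed point \<open>(c, 0)\<close> of the unperturbed problem.\<close>
    have "norm (c' - c) \<le> k' * norm (c' - c) + l * norm w"
      using F_lip[OF cw(1,2) X(3) Y0] by (simp add: F_c cw)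
    also have "\<dots> \<le> k' * norm (c' - c) + l * (\<bar>\<epsilon>\<bar> * (T * (2 * M)))"
      using w_small l by (intro add_left_mono mult_left_mono)
    finally have c'_small: "norm (c' - c) \<le> l * (T * (2 * M)) / (1 - k') * \<bar>\<epsilon>\<bar>"
      using k' by (simp add: field_simps)
    show "\<exists>u. continuous_on UNIV u \<and> (\<forall>t. u (t + T) = u t) \<and>
      (\<forall>t. t \<notin> D \<longrightarrow> (u has_vector_derivative \<epsilon> *\<^sub>R H t (u t)) (at t)) \<and>
      (\<forall>t. norm (u t - c) \<le> C * \<bar>\<epsilon>\<bar>)"
    proof (intro exI[of _ "\<lambda>t. c' + w t"] conjI allI impI)
      show "continuous_on UNIV (\<lambda>t. c' + w t)" by (intro continuous_intros) simp
      show "c' + w (t + T) = c' + w t" for t using cw by (simp add: Y_def)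
      show "((\<lambda>t. c' + w t) has_vector_derivative \<epsilon> *\<^sub>R H t (c' + w t)) (at t)" if "t \<notin> D" for t
      proof -
        have "(primitive (f c' w) has_vector_derivative f c' w t) (at t)"
          by (intro primitive_has_vector_derivative f_int cw f_cont that)
        then have "((\<lambda>t. c' + \<epsilon> *\<^sub>R primitive (f c' w) t) has_vector_derivative \<epsilon> *\<^sub>R f c' w t) (at t)"
          by (auto intro!: derivative_eq_intros)
        then show ?thesis by (simp add: f_def flip: w_eq)
      qed
      show "norm (c' + w t - c) \<le> C * \<bar>\<epsilon>\<bar>" for t
        using norm_triangle_ineq[of "c' - c" "w t"] norm_bounded[of w t] w_small c'_small
        by (simp add: C_def algebra_simps)
    qed
  qed
qed

section \<open>Periodic functions satisfying the Dirichlet conditions\<close>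

lemma periodic_bounded:
  assumes T: "0 < T" and per: "\<And>t. f (t + T) = f t" and "bounded (f ` {0..T::real})"
  obtains B :: real where "0 \<le> B" "\<And>t. norm (f t) \<le> B"
proof -
  obtain B where B: "\<And>s. s \<in> {0..T} \<Longrightarrow> norm (f s) \<le> B"
    using \<open>bounded (f ` {0..T})\<close> unfolding bounded_iff by blast
  have le: "norm (f t) \<le> B" for t
    by (rule periodic_reduce_to_period[OF T, of f t, OF per]) (use B in auto)
  have "0 \<le> B" using norm_ge_zero le[of 0] by (rule order_trans)
  then show thesis using le by (rule that)
qed

text \<open>
  Discontinuities in \<open>{a..b}\<close> are translates of those in one period by one of the finitely many
  multiples of \<open>T\<close> that can reach \<open>{a..b}\<close>.
\<close>
lemma periodic_discontinuities_locally_finite: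
  fixes f :: "real \<Rightarrow> real"
  assumes T: "0 < T" and per: "\<And>t. f (t + T) = f t"
    and fin: "finite {t \<in> {0..<T}. \<not> isCont f t}"
  shows "finite ({t. \<not> isCont f t} \<inter> {a..b})"
proof -
  interpret f: periodic_fun_simple f T by standard (rule per)
  let ?E = "{t \<in> {0..<T}. \<not> isCont f t}"
  let ?I = "{\<lfloor>a / T\<rfloor> - 1..\<lfloor>b / T\<rfloor>}"
  have "{t. \<not> isCont f t} \<inter> {a..b} \<subseteq> (\<lambda>(n, s). s + of_int n * T) ` (?I \<times> ?E)"
  proof clarify
    fix t assume t: "\<not> isCont f t" "t \<in> {a..b}"
    obtain s n where s: "s \<in> {0..<T}" "t = s + of_int n * T"
      using periodic_reduce_to_period[where f=f and t=t, OF T per] by metis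
    have "\<not> isCont f s"
    proof
      assume "isCont f s"
      then have "isCont (\<lambda>x. f (x - of_int n * T)) t"
        using isCont_o2[of t "\<lambda>x. x - of_int n * T" f] s(2) by simp
      then show False using t f.minus_of_int by simp
    qed
    moreover have "n \<in> ?I"
    proof -
      have "of_int n \<le> b / T" "a / T < of_int n + 1"
        using s t T by (auto simp: field_simps)
      then have "n \<le> \<lfloor>b / T\<rfloor>" "\<lfloor>a / T\<rfloor> < n + 1"
        by linarith+
      then show ?thesis by simp
    qed
    ultimately show "t \<in> (\<lambda>(n, s). s + of_int n * T) ` (?I \<times> ?E)"
      using s by (intro image_eqI[of _ _ "(n, s)"]) auto
  qed
  moreover have "finite ((\<lambda>(n, s). s + of_int n * T) ` (?I \<times> ?E))"
    using fin by (intro finite_imageI finite_cartesian_product) auto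
  ultimately show ?thesis by (rule finite_subset)
qed

section \<open>The cubic resonance term\<close>

text \<open>
  The averaged cubic force is a multiple of \<open>\<bar>u\<bar>\<^sup>2 u = u\<^sup>2 cnj u\<close>.  This map is not complex
  differentiable; its real-linear derivative at \<open>z\<close> is \<open>w \<mapsto> 2 \<bar>z\<bar>\<^sup>2 w + z\<^sup>2 cnj w\<close>, and the difference
  factors through the deviations of \<open>u\<close> and \<open>v\<close> from \<open>z\<close>, which gives the explicit constant.
\<close>
lemma cubic_strict_derivative:
  fixes z u v :: complex
  assumes u: "norm (u - z) \<le> r" and v: "norm (v - z) \<le> r" and r: "r \<le> norm z"
  shows "norm (u\<^sup>2 * cnj u - v\<^sup>2 * cnj v - (2 * (z * cnj z) * (u - v) + z\<^sup>2 * cnj (u - v)))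
    \<le> 9 * r * norm z * norm (u - v)"
proof -
  have r0: "0 \<le> r" using u norm_ge_zero order_trans by blast
  let ?p = "((u - z) + (v - z)) * cnj u + 2 * z * cnj (u - z)"
  let ?q = "(v - z) * (v + z)"
  have eq: "u\<^sup>2 * cnj u - v\<^sup>2 * cnj v - (2 * (z * cnj z) * (u - v) + z\<^sup>2 * cnj (u - v)) =
      ?p * (u - v) + ?q * cnj (u - v)"
    by (simp add: algebra_simps power2_eq_square)
  have nu: "norm u \<le> 2 * norm z"
    using norm_triangle_ineq[of "u - z" z] u r by simp
  have nv: "norm (v + z) \<le> 3 * norm z"
    using norm_triangle_ineq[of "v - z" "2 * z"] v r by (simp add: norm_mult add.commute)
  have uv: "norm ((u - z) + (v - z)) \<le> 2 * r"
    using norm_triangle_ineq[of "u - z" "v - z"] u v by simp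
  have "norm ?p \<le> (2 * r) * (2 * norm z) + 2 * norm z * r"
  proof (rule norm_triangle_mono)
    show "norm (((u - z) + (v - z)) * cnj u) \<le> (2 * r) * (2 * norm z)"
      unfolding norm_mult complex_mod_cnj using uv nu r0 by (intro mult_mono) auto
    show "norm (2 * z * cnj (u - z)) \<le> 2 * norm z * r"
      unfolding norm_mult complex_mod_cnj using u by (intro mult_mono) auto
  qed
  moreover have "norm ?q \<le> r * (3 * norm z)"
    unfolding norm_mult using v nv r0 by (intro mult_mono) auto
  ultimately have pq: "norm ?p + norm ?q \<le> 9 * r * norm z" by simp
  have "norm (?p * (u - v) + ?q * cnj (u - v)) \<le> (norm ?p + norm ?q) * norm (u - v)"
    using norm_triangle_ineq[of "?p * (u - v)" "?q * cnj (u - v)"]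
    unfolding norm_mult[of ?p] norm_mult[of ?q] complex_mod_cnj distrib_right[of "norm ?p" "norm ?q"] .
  also have "\<dots> \<le> 9 * r * norm z * norm (u - v)"
    by (rule mult_right_mono[OF pq]) simp
  finally show ?thesis unfolding eq .
qed

text \<open>
  The derivative \<open>D\<close> of \<open>u\<^sup>2 cnj u\<close> at \<open>z\<close> is inverted by applying its conjugate companion:
  \<open>2 \<bar>z\<bar>\<^sup>2 D w - z\<^sup>2 cnj (D w) = (4 - 1) \<bar>z\<bar>\<^sup>4 w\<close>.  So \<open>Q\<close> has norm at most \<open>1 / \<bar>z\<bar>\<^sup>2\<close>, and the radius
  \<open>\<bar>z\<bar> / 18\<close> turns the constant \<open>9 r \<bar>z\<bar>\<close> of \<open>cubic_strict_derivative\<close> into \<open>1 / 2\<close>.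
\<close>
lemma cubic_newton:
  fixes z :: complex
  assumes z: "z \<noteq> 0"
  shows "\<exists>Q. bounded_linear Q \<and> (\<forall>w. Q w = 0 \<longrightarrow> w = 0) \<and>
    (\<forall>u\<in>cball z (norm z / 18). \<forall>v\<in>cball z (norm z / 18).
      norm (u - v - Q (u\<^sup>2 * cnj u - v\<^sup>2 * cnj v)) \<le> 1 / 2 * norm (u - v))"
proof -
  define \<rho> where "\<rho> = z * cnj z"
  have \<rho>: "\<rho> = of_real ((norm z)\<^sup>2)" "\<rho> \<noteq> 0" "norm \<rho> = (norm z)\<^sup>2"
    using z unfolding \<rho>_def complex_norm_square by (simp_all add: norm_mult power2_eq_square)
  define Q where "Q w = (2 * \<rho> * w - z\<^sup>2 * cnj w) / (3 * \<rho>\<^sup>2)" for w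
  define D where "D w = 2 * \<rho> * w + z\<^sup>2 * cnj w" for w
  have QD: "Q (D w) = w" for w
  proof -
    have "cnj \<rho> = \<rho>" by (simp add: \<rho>_def)
    then have "2 * \<rho> * D w - z\<^sup>2 * cnj (D w) = 4 * \<rho>\<^sup>2 * w - (z * cnj z)\<^sup>2 * w"
      by (simp add: D_def algebra_simps power2_eq_square)
    also have "\<dots> = 3 * \<rho>\<^sup>2 * w" by (simp add: \<rho>_def)
    finally show ?thesis using \<rho> by (simp add: Q_def)
  qed
  have lin: "bounded_linear Q"
    unfolding Q_def divide_inverse
    by (intro bounded_linear_intros bounded_linear_sub bounded_linear_cnj)
  interpret Q: bounded_linear Q by (rule lin)
  have Q_le: "norm (Q w) \<le> norm w / (norm z)\<^sup>2" for w
  proof -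
    have "norm (2 * \<rho> * w - z\<^sup>2 * cnj w) \<le> 3 * (norm z)\<^sup>2 * norm w"
      using norm_triangle_ineq4[of "2 * \<rho> * w" "z\<^sup>2 * cnj w"]
      by (simp add: norm_mult norm_power \<rho>(3) mult_ac)
    then have "norm (Q w) \<le> 3 * (norm z)\<^sup>2 * norm w / (3 * ((norm z)\<^sup>2)\<^sup>2)"
      unfolding Q_def norm_divide
      by (simp only: norm_mult norm_power \<rho>(3) norm_numeral) (rule divide_right_mono, simp_all)
    also have "\<dots> = norm w / (norm z)\<^sup>2" using z by (simp add: power2_eq_square)
    finally show ?thesis .
  qed
  show ?thesis
  proof (intro exI[of _ Q] conjI allI ballI impI lin)
    fix w assume "Q w = 0"
    then have "2 * \<rho> * w = z\<^sup>2 * cnj w" using \<rho> by (simp add: Q_def)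
    then have "norm (2 * \<rho> * w) = norm (z\<^sup>2 * cnj w)" by simp
    then have "2 * (norm z)\<^sup>2 * norm w = (norm z)\<^sup>2 * norm w" by (simp add: norm_mult norm_power \<rho>(3))
    then show "w = 0" using z by simp
  next
    fix u v assume "u \<in> cball z (norm z / 18)" "v \<in> cball z (norm z / 18)"
    then have "norm (u - z) \<le> norm z / 18" "norm (v - z) \<le> norm z / 18"
      by (simp_all add: dist_norm norm_minus_commute)
    then have "norm (u\<^sup>2 * cnj u - v\<^sup>2 * cnj v - D (u - v)) \<le> 9 * (norm z / 18) * norm z * norm (u - v)"
      unfolding D_def \<rho>_def by (intro cubic_strict_derivative) auto
    then have le: "norm (u\<^sup>2 * cnj u - v\<^sup>2 * cnj v - D (u - v)) / (norm z)\<^sup>2 \<le> 1 / 2 * norm (u - v)"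
      using z by (simp add: field_simps power2_eq_square)
    have "u - v - Q (u\<^sup>2 * cnj u - v\<^sup>2 * cnj v) = - Q (u\<^sup>2 * cnj u - v\<^sup>2 * cnj v - D (u - v))"
      by (simp only: Q.diff QD) simp
    then have "norm (u - v - Q (u\<^sup>2 * cnj u - v\<^sup>2 * cnj v)) = norm (Q (u\<^sup>2 * cnj u - v\<^sup>2 * cnj v - D (u - v)))"
      by (simp only: norm_minus_cancel)
    also note Q_le
    also note le
    finally show "norm (u - v - Q (u\<^sup>2 * cnj u - v\<^sup>2 * cnj v)) \<le> 1 / 2 * norm (u - v)" .
  qed
qed

section \<open>The oscillator in rotating coordinates\<close>

text \<open>
  Put \<open>z = x + \<i> y / \<omega>\<close>.  The unperturbed oscillator is \<open>z' = - \<i> \<omega> z\<close>, so the slowly varying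
  amplitude is \<open>u = z exp (\<i> \<omega> t)\<close>.  The perturbed system becomes \<open>u' = \<epsilon> H(t, u)\<close>, where \<open>H\<close> is the
  following field.
\<close>
definition rotating_field :: "real \<Rightarrow> real \<Rightarrow> (real \<Rightarrow> real) \<Rightarrow> real \<Rightarrow> complex \<Rightarrow> complex" where
  "rotating_field \<omega> \<alpha> f t u = (let x = Re (u * cis (- (\<omega> * t))) in
     \<i> / of_real \<omega> * cis (\<omega> * t) * of_real (f t - \<alpha> * x ^ 3 - cos (\<omega> * t) * x))"

lemma cis_has_vector_derivative:
  "((\<lambda>t. cis (k * t)) has_vector_derivative (\<i> * of_real k * cis (k * t))) (at t within S)"
proof -
  have "((\<lambda>t. k * t) has_derivative (\<lambda>h. k * h)) (at t within S)"
    by (auto intro!: derivative_eq_intros)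
  then have "((\<lambda>t. cis (k * t)) has_derivative (\<lambda>h. (k * h) *\<^sub>R (\<i> * cis (k * t)))) (at t within S)"
    by (rule has_derivative_cis)
  then show ?thesis
    by (simp add: has_vector_derivative_def scaleR_conv_of_real mult_ac)
qed

lemma has_integral_cis_period:
  fixes k :: int
  assumes "k \<noteq> 0" "0 < \<omega>"
  shows "((\<lambda>t. cis (of_int k * (\<omega> * t))) has_integral 0) {0..2 * pi / \<omega>}"
proof -
  let ?c = "\<i> * of_real (of_int k * \<omega>)"
  have c: "?c \<noteq> 0" using assms by simp
  have "((\<lambda>t. cis (of_int k * \<omega> * t)) has_integral
      cis (of_int k * \<omega> * (2 * pi / \<omega>)) / ?c - cis (of_int k * \<omega> * 0) / ?c) {0..2 * pi / \<omega>}"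
  proof (rule fundamental_theorem_of_calculus)
    fix t
    have "((\<lambda>t. cis (of_int k * \<omega> * t) / ?c) has_vector_derivative
        ?c * cis (of_int k * \<omega> * t) / ?c) (at t within {0..2 * pi / \<omega>})"
      by (rule bounded_linear.has_vector_derivative[OF bounded_linear_divide cis_has_vector_derivative])
    then show "((\<lambda>t. cis (of_int k * \<omega> * t) / ?c) has_vector_derivative
        cis (of_int k * \<omega> * t)) (at t within {0..2 * pi / \<omega>})"
      using c by simp
  qed (use assms in auto)
  moreover have "cis (of_int k * \<omega> * (2 * pi / \<omega>)) = 1"
    using assms cis_multiple_2pi[of "of_int k"] by (simp add: mult_ac)
  ultimately show ?thesis by (simp add: mult.assoc)
qed

text \<open>
  The field sorted by harmonics.  Apart from the forcing \<open>f\<close>, the only term of frequency zero is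
  \<open>3 u\<^sup>2 cnj u\<close>; the parametric excitation \<open>cos (\<omega> t) x\<close> contributes odd harmonics alone and
  therefore disappears from the average.
\<close>
lemma rotating_field_expand:
  "rotating_field \<omega> \<alpha> f t u = \<i> / of_real \<omega> * (of_real (f t * cos (\<omega> * t)) + \<i> * of_real (f t * sin (\<omega> * t))
    - of_real \<alpha> / 8 * (u ^ 3 * cis (of_int (-2) * (\<omega> * t)) + 3 * (u\<^sup>2 * cnj u)
        + 3 * (u * (cnj u)\<^sup>2) * cis (of_int 2 * (\<omega> * t)) + (cnj u) ^ 3 * cis (of_int 4 * (\<omega> * t)))
    - 1 / 4 * (u * cis (of_int 1 * (\<omega> * t)) + cnj u * cis (of_int 3 * (\<omega> * t))
        + u * cis (of_int (-1) * (\<omega> * t)) + cnj u * cis (of_int 1 * (\<omega> * t))))"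
proof -
  define E where "E = cis (\<omega> * t)"
  define F where "F = cis (- (\<omega> * t))"
  have EF: "E * F = 1" by (simp add: E_def F_def cis_mult)
  have pow: "cis (of_int 2 * (\<omega> * t)) = E ^ 2" "cis (of_int 3 * (\<omega> * t)) = E ^ 3"
    "cis (of_int 4 * (\<omega> * t)) = E ^ 4" "cis (of_int (-2) * (\<omega> * t)) = F ^ 2"
    "cis (of_int 1 * (\<omega> * t)) = E" "cis (of_int (-1) * (\<omega> * t)) = F"
    using Complex.DeMoivre[of "\<omega> * t" 2] Complex.DeMoivre[of "\<omega> * t" 3] Complex.DeMoivre[of "\<omega> * t" 4]
      Complex.DeMoivre[of "- (\<omega> * t)" 2]
    by (simp_all add: E_def F_def)
  have x: "of_real (Re (u * F)) = (u * F + cnj u * E) / 2"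
    using complex_add_cnj[of "u * F"] by (simp add: E_def F_def cis_cnj)
  have c: "of_real (cos (\<omega> * t)) = (E + F) / 2"
    by (simp add: E_def F_def complex_eq_iff)
  have fE: "of_real (f t * cos (\<omega> * t)) + \<i> * of_real (f t * sin (\<omega> * t)) = of_real (f t) * E"
    by (simp add: E_def complex_eq_iff)
  have "E * (u * F + cnj u * E) ^ 3 = u ^ 3 * F ^ 2 * (E * F) + 3 * (u\<^sup>2 * cnj u) * (E * F) * (E * F)
      + 3 * (u * (cnj u)\<^sup>2) * E ^ 2 * (E * F) + (cnj u) ^ 3 * E ^ 4"
    by (simp add: algebra_simps power2_eq_square power3_eq_cube power4_eq_xxxx)
  then have c3: "E * (u * F + cnj u * E) ^ 3 = u ^ 3 * F ^ 2 + 3 * (u\<^sup>2 * cnj u)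
      + 3 * (u * (cnj u)\<^sup>2) * E ^ 2 + (cnj u) ^ 3 * E ^ 4"
    by (simp add: EF)
  have "E * ((E + F) * (u * F + cnj u * E)) =
      u * E * (E * F) + cnj u * E ^ 3 + u * F * (E * F) + cnj u * E * (E * F)"
    by (simp add: algebra_simps power3_eq_cube)
  then have c1: "E * ((E + F) * (u * F + cnj u * E)) = u * E + cnj u * E ^ 3 + u * F + cnj u * E"
    by (simp add: EF)
  have "rotating_field \<omega> \<alpha> f t u = \<i> / of_real \<omega> * (of_real (f t) * E
      - of_real \<alpha> / 8 * (E * (u * F + cnj u * E) ^ 3) - 1 / 4 * (E * ((E + F) * (u * F + cnj u * E))))"
    unfolding rotating_field_def Let_def
    unfolding of_real_diff of_real_mult of_real_power F_def[symmetric] E_def[symmetric] x c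
    by (simp add: field_simps power_divide)
  then show ?thesis unfolding c3 c1 fE pow .
qed

lemma rotating_field_average:
  fixes f :: "real \<Rightarrow> real"
  assumes \<omega>: "0 < \<omega>" and T: "T = 2 * pi / \<omega>"
    and int: "(\<lambda>t. f t * cos (\<omega> * t)) integrable_on {0..T}" "(\<lambda>t. f t * sin (\<omega> * t)) integrable_on {0..T}"
  shows "integral {0..T} (\<lambda>t. rotating_field \<omega> \<alpha> f t u) =
    \<i> * of_real T / (2 * of_real \<omega>) *
      (Complex (fourier_cos T f 1) (fourier_sin T f 1) - 3 * of_real \<alpha> / 4 * (u\<^sup>2 * cnj u))"
proof -
  have T0: "0 < T" "2 * pi / T = \<omega>" using \<omega> T by simp_all
  have fc: "((\<lambda>t. complex_of_real (f t * cos (\<omega> * t))) has_integral of_real (T / 2 * fourier_cos T f 1)) {0..T}"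
    using has_integral_linear[OF integrable_integral[OF int(1)] bounded_linear_of_real] T0
    by (simp add: fourier_cos_def o_def)
  have fs: "((\<lambda>t. complex_of_real (f t * sin (\<omega> * t))) has_integral of_real (T / 2 * fourier_sin T f 1)) {0..T}"
    using has_integral_linear[OF integrable_integral[OF int(2)] bounded_linear_of_real] T0
    by (simp add: fourier_sin_def o_def)
  note cis0 = has_integral_cis_period[OF _ \<omega>, folded T]
  have const: "((\<lambda>t. 3 * (u\<^sup>2 * cnj u)) has_integral of_real T * (3 * (u\<^sup>2 * cnj u))) {0..T}"
    using has_integral_const_real[of "3 * (u\<^sup>2 * cnj u)" 0 T] T0 by (simp add: scaleR_conv_of_real)
  have "((\<lambda>t. rotating_field \<omega> \<alpha> f t u) has_integral
      \<i> / of_real \<omega> * (of_real (T / 2 * fourier_cos T f 1) + \<i> * of_real (T / 2 * fourier_sin T f 1)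
      - of_real \<alpha> / 8 * (u ^ 3 * 0 + of_real T * (3 * (u\<^sup>2 * cnj u)) + 3 * (u * (cnj u)\<^sup>2) * 0 + (cnj u) ^ 3 * 0)
      - 1 / 4 * (u * 0 + cnj u * 0 + u * 0 + cnj u * 0))) {0..T}"
    unfolding rotating_field_expand
    by (intro has_integral_mult_right has_integral_add has_integral_diff fc fs const cis0) auto
  then have "integral {0..T} (\<lambda>t. rotating_field \<omega> \<alpha> f t u) =
      \<i> / of_real \<omega> * (of_real (T / 2 * fourier_cos T f 1) + \<i> * of_real (T / 2 * fourier_sin T f 1)
      - of_real \<alpha> / 8 * (of_real T * (3 * (u\<^sup>2 * cnj u))))"
    by (simp add: integral_unique)
  also have "\<dots> = \<i> * of_real T / (2 * of_real \<omega>) *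
      (Complex (fourier_cos T f 1) (fourier_sin T f 1) - 3 * of_real \<alpha> / 4 * (u\<^sup>2 * cnj u))"
    using \<omega> by (simp add: Complex_eq field_simps)
  finally show ?thesis .
qed

text \<open>
  The first bound comes from \<open>x\<^sup>3 - y\<^sup>3 = (x\<^sup>2 + x y + y\<^sup>2) (x - y)\<close>.  In the second difference \<open>f\<close> and
  the term linear in \<open>x\<close> cancel, and the cubes leave \<open>3 (x + d + y) d (x - y)\<close>.
\<close>
lemma rotating_field_diff:
  fixes u v w :: complex
  assumes \<omega>: "0 < \<omega>" and K: "norm u \<le> K" "norm v \<le> K" "norm (u + w) \<le> K" "norm (v + w) \<le> K"
  shows "norm (rotating_field \<omega> \<alpha> f t u - rotating_field \<omega> \<alpha> f t v)
      \<le> (3 * \<bar>\<alpha>\<bar> * K\<^sup>2 + 1) / \<omega> * norm (u - v)" (is ?A)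
    and "norm ((rotating_field \<omega> \<alpha> f t (u + w) - rotating_field \<omega> \<alpha> f t u) -
        (rotating_field \<omega> \<alpha> f t (v + w) - rotating_field \<omega> \<alpha> f t v))
      \<le> 6 * \<bar>\<alpha>\<bar> * K / \<omega> * norm w * norm (u - v)" (is ?B)
proof -
  define F where "F = cis (- (\<omega> * t))"
  define x y d where "x = Re (u * F)" and "y = Re (v * F)" and "d = Re (w * F)"
  have Re_le: "\<bar>Re (z * F)\<bar> \<le> norm z" for z
    using abs_Re_le_cmod[of "z * F"] by (simp add: F_def norm_mult)
  have xy: "\<bar>x - y\<bar> \<le> norm (u - v)" and d: "\<bar>d\<bar> \<le> norm w"
    using Re_le[of "u - v"] Re_le[of w] by (simp_all add: x_def y_def d_def algebra_simps)
  have x: "\<bar>x\<bar> \<le> K" and y: "\<bar>y\<bar> \<le> K" and xd: "\<bar>x + d\<bar> \<le> K"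
    using Re_le[of u] Re_le[of v] Re_le[of "u + w"] K
    by (simp_all add: x_def y_def d_def algebra_simps)
  have K0: "0 \<le> K" using x by linarith
  have field: "rotating_field \<omega> \<alpha> f t z = \<i> / of_real \<omega> * cis (\<omega> * t) *
      of_real (f t - \<alpha> * Re (z * F) ^ 3 - cos (\<omega> * t) * Re (z * F))" for z
    by (simp add: rotating_field_def F_def Let_def)
  have norm_field: "norm (\<i> / of_real \<omega> * cis (\<omega> * t) * of_real s) = \<bar>s\<bar> / \<omega>" for s
    using \<omega> by (simp add: norm_mult norm_divide)
  show ?A
  proof -
    have "rotating_field \<omega> \<alpha> f t u - rotating_field \<omega> \<alpha> f t v = \<i> / of_real \<omega> * cis (\<omega> * t) *
        of_real (- ((\<alpha> * (x\<^sup>2 + x * y + y\<^sup>2) + cos (\<omega> * t)) * (x - y)))"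
      unfolding field x_def[symmetric] y_def[symmetric]
      by (simp add: algebra_simps power2_eq_square power3_eq_cube)
    then have "norm (rotating_field \<omega> \<alpha> f t u - rotating_field \<omega> \<alpha> f t v) =
        \<bar>\<alpha> * (x\<^sup>2 + x * y + y\<^sup>2) + cos (\<omega> * t)\<bar> * \<bar>x - y\<bar> / \<omega>"
      by (simp only: norm_field abs_minus_cancel abs_mult)
    also have "\<dots> \<le> (3 * \<bar>\<alpha>\<bar> * K\<^sup>2 + 1) * norm (u - v) / \<omega>"
    proof (intro divide_right_mono mult_mono xy)
      have "\<bar>x\<^sup>2\<bar> \<le> K * K" "\<bar>x * y\<bar> \<le> K * K" "\<bar>y\<^sup>2\<bar> \<le> K * K"
        unfolding power2_eq_square abs_mult using x y K0 by (intro mult_mono; simp)+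
      then have "\<bar>x\<^sup>2 + x * y + y\<^sup>2\<bar> \<le> 3 * (K * K)" by linarith
      then have "\<bar>\<alpha> * (x\<^sup>2 + x * y + y\<^sup>2)\<bar> \<le> \<bar>\<alpha>\<bar> * (3 * (K * K))"
        unfolding abs_mult by (rule mult_left_mono) simp
      then show "\<bar>\<alpha> * (x\<^sup>2 + x * y + y\<^sup>2) + cos (\<omega> * t)\<bar> \<le> 3 * \<bar>\<alpha>\<bar> * K\<^sup>2 + 1"
        using abs_cos_le_one[of "\<omega> * t"]
          abs_triangle_ineq[of "\<alpha> * (x\<^sup>2 + x * y + y\<^sup>2)" "cos (\<omega> * t)"]
        unfolding power2_eq_square[of K] by linarith
    qed (use \<omega> K0 in auto)
    finally show ?thesis by simp
  qed
  show ?B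
  proof -
    have Re_add: "Re ((z + w) * F) = Re (z * F) + d" for z
      by (simp add: d_def distrib_right)
    have "(rotating_field \<omega> \<alpha> f t (u + w) - rotating_field \<omega> \<alpha> f t u) -
        (rotating_field \<omega> \<alpha> f t (v + w) - rotating_field \<omega> \<alpha> f t v) = \<i> / of_real \<omega> * cis (\<omega> * t) *
        of_real (- (3 * \<alpha> * ((x + d) + y) * d * (x - y)))"
      unfolding field Re_add x_def[symmetric] y_def[symmetric]
      by (simp add: algebra_simps power2_eq_square power3_eq_cube)
    then have "norm ((rotating_field \<omega> \<alpha> f t (u + w) - rotating_field \<omega> \<alpha> f t u) -
        (rotating_field \<omega> \<alpha> f t (v + w) - rotating_field \<omega> \<alpha> f t v)) =
        3 * \<bar>\<alpha>\<bar> * \<bar>(x + d) + y\<bar> * \<bar>d\<bar> * \<bar>x - y\<bar> / \<omega>"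
      by (simp only: norm_field abs_minus_cancel abs_mult abs_numeral)
    also have "\<dots> \<le> 3 * \<bar>\<alpha>\<bar> * (2 * K) * norm w * norm (u - v) / \<omega>"
      using xd y xy d \<omega> K0 by (intro divide_right_mono mult_mono) auto
    finally show ?thesis by simp
  qed
qed

lemma rotating_field_bound:
  assumes \<omega>: "0 < \<omega>" and K: "norm u \<le> K" and B: "\<bar>f t\<bar> \<le> B"
  shows "norm (rotating_field \<omega> \<alpha> f t u) \<le> (B + \<bar>\<alpha>\<bar> * K ^ 3 + K) / \<omega>"
proof -
  define x where "x = Re (u * cis (- (\<omega> * t)))"
  have x: "\<bar>x\<bar> \<le> K"
    using abs_Re_le_cmod[of "u * cis (- (\<omega> * t))"] K by (simp add: x_def norm_mult)
  have "norm (rotating_field \<omega> \<alpha> f t u) = \<bar>f t - \<alpha> * x ^ 3 - cos (\<omega> * t) * x\<bar> / \<omega>"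
    unfolding rotating_field_def Let_def x_def[symmetric] using \<omega>
    by (simp only: norm_mult norm_divide norm_cis norm_of_real norm_ii) simp
  also have "\<dots> \<le> (B + \<bar>\<alpha>\<bar> * K ^ 3 + 1 * K) / \<omega>"
  proof (intro divide_right_mono)
    have "\<bar>\<alpha> * x ^ 3\<bar> \<le> \<bar>\<alpha>\<bar> * K ^ 3"
      unfolding abs_mult power_abs using x by (intro mult_left_mono power_mono) auto
    moreover have "\<bar>cos (\<omega> * t) * x\<bar> \<le> 1 * K"
      unfolding abs_mult using x by (intro mult_mono) auto
    ultimately show "\<bar>f t - \<alpha> * x ^ 3 - cos (\<omega> * t) * x\<bar> \<le> B + \<bar>\<alpha>\<bar> * K ^ 3 + 1 * K"
      using B by linarith
  qed (use \<omega> in auto)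
  finally show ?thesis by simp
qed

lemma isCont_rotating_field:
  assumes "isCont f t" "isCont v t"
  shows "isCont (\<lambda>s. rotating_field \<omega> \<alpha> f s (v s)) t"
proof -
  have cis: "isCont (\<lambda>s. cis (k * s)) t" for k
    by (rule has_vector_derivative_continuous[OF cis_has_vector_derivative])
  have "isCont (\<lambda>s. Re (v s * cis (- (\<omega> * s)))) t"
    using assms(2) cis[of "- \<omega>"] by (intro isCont_Re isCont_mult) simp_all
  then show ?thesis
    unfolding rotating_field_def Let_def by (intro continuous_intros assms cis)
qed

text \<open>
  Returning to \<open>z = u exp (- \<i> \<omega> t)\<close>, the real part of \<open>\<epsilon> H\<close> in this frame vanishes, so that
  \<open>x' = y\<close> involves only continuous functions and extends to the points where \<open>f\<close> jumps, by
  \<open>has_real_derivative_extend\<close>.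
\<close>
lemma forced_osc_solution_from_rotating:
  fixes u :: "real \<Rightarrow> complex"
  assumes \<omega>: "0 < \<omega>" and cont: "continuous_on UNIV u"
    and fin: "\<And>a b. finite ({t. \<not> isCont f t} \<inter> {a..b})"
    and deriv: "\<And>t. isCont f t \<Longrightarrow> (u has_vector_derivative \<epsilon> *\<^sub>R rotating_field \<omega> \<alpha> f t (u t)) (at t)"
  shows "forced_osc_solution \<omega> \<alpha> f \<epsilon>
    (\<lambda>t. Re (u t * cis (- (\<omega> * t)))) (\<lambda>t. \<omega> * Im (u t * cis (- (\<omega> * t))))"
proof -
  define z where "z t = u t * cis (- (\<omega> * t))" for t
  have z_cont: "continuous_on UNIV z"
    unfolding z_def by (intro continuous_intros cont)
  have z_deriv: "(z has_vector_derivative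
      \<i> * of_real (\<epsilon> * (f t - \<alpha> * Re (z t) ^ 3 - cos (\<omega> * t) * Re (z t)) / \<omega>) - \<i> * of_real \<omega> * z t) (at t)"
    if "isCont f t" for t
  proof -
    have EF: "cis (- (\<omega> * t)) * cis (\<omega> * t) = 1" by (simp add: cis_mult)
    have "(z has_vector_derivative u t * (\<i> * of_real (- \<omega>) * cis (- \<omega> * t)) +
        (\<epsilon> *\<^sub>R rotating_field \<omega> \<alpha> f t (u t)) * cis (- \<omega> * t)) (at t)"
      using has_vector_derivative_mult[OF deriv[OF that] cis_has_vector_derivative[of "- \<omega>" t UNIV]]
      by (simp add: z_def[abs_def])
    moreover have "u t * (\<i> * of_real (- \<omega>) * cis (- \<omega> * t)) +
        (\<epsilon> *\<^sub>R rotating_field \<omega> \<alpha> f t (u t)) * cis (- \<omega> * t) =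
        \<i> * of_real (\<epsilon> * (f t - \<alpha> * Re (z t) ^ 3 - cos (\<omega> * t) * Re (z t)) / \<omega>) * (cis (- (\<omega> * t)) * cis (\<omega> * t))
        - \<i> * of_real \<omega> * z t"
      unfolding rotating_field_def Let_def z_def[symmetric]
      by (simp add: scaleR_conv_of_real) (simp add: z_def algebra_simps)
    ultimately show ?thesis unfolding EF by simp
  qed
  have x: "((\<lambda>t. Re (z t)) has_real_derivative \<omega> * Im (z t)) (at t)" for t
  proof (rule has_real_derivative_extend[OF fin])
    show "((\<lambda>t. Re (z t)) has_real_derivative \<omega> * Im (z t)) (at t)" if "t \<notin> {t. \<not> isCont f t}" for t
      using bounded_linear.has_vector_derivative[OF bounded_linear_Re z_deriv[of t]] that
      by (simp add: has_real_derivative_iff_has_vector_derivative)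
  qed (intro continuous_intros z_cont)+
  have y: "((\<lambda>t. \<omega> * Im (z t)) has_real_derivative
      - (\<omega>\<^sup>2) * Re (z t) + \<epsilon> * (f t - \<alpha> * Re (z t) ^ 3 - cos (\<omega> * t) * Re (z t))) (at t)"
    if "isCont f t" for t
  proof -
    have "((\<lambda>t. Im (z t)) has_real_derivative
        \<epsilon> * (f t - \<alpha> * Re (z t) ^ 3 - cos (\<omega> * t) * Re (z t)) / \<omega> - \<omega> * Re (z t)) (at t)"
      using bounded_linear.has_vector_derivative[OF bounded_linear_Im z_deriv[OF that]]
      by (simp add: has_real_derivative_iff_has_vector_derivative)
    from DERIV_cmult[OF this, of \<omega>] show ?thesis
      by (rule DERIV_cong) (use \<omega> in \<open>simp add: field_simps power2_eq_square\<close>)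
  qed
  have "continuous_on UNIV (\<lambda>t. \<omega> * Im (z t))" by (intro continuous_intros z_cont)
  with x y show ?thesis unfolding forced_osc_solution_def z_def[symmetric] by blast
qed

section \<open>The periodic solution of the oscillator\<close>

theorem theorem1:
  fixes \<omega> \<alpha> T x\<^sub>0 y\<^sub>0 :: real and f :: "real \<Rightarrow> real" and a b :: "nat \<Rightarrow> real"
  assumes "\<omega> > 0" and "\<alpha> \<noteq> 0" and "T = 2 * pi / \<omega>"
    and "periodic_fun_simple f T"
    and "dirichlet_conditions T f"
    and "integral {0..T} f = 0"
    and "a = fourier_cos T f" and "b = fourier_sin T f"
    and "a 1 \<noteq> 0 \<or> b 1 \<noteq> 0"
    and "x\<^sub>0 = root 3 (4 * a 1 ^ 3 / (3 * \<alpha> * (a 1 ^ 2 + b 1 ^ 2)))"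
    and "y\<^sub>0 = root 3 (4 * b 1 ^ 3 * \<omega> ^ 3 / (3 * \<alpha> * (a 1 ^ 2 + b 1 ^ 2)))"
  shows "\<exists>\<epsilon>\<^sub>0>0. \<exists>x y :: real \<Rightarrow> real \<Rightarrow> real.
    (\<forall>\<epsilon>. \<bar>\<epsilon>\<bar> < \<epsilon>\<^sub>0 \<longrightarrow>
       forced_osc_solution \<omega> \<alpha> f \<epsilon> (x \<epsilon>) (y \<epsilon>) \<and>
       periodic_fun_simple (x \<epsilon>) T \<and> periodic_fun_simple (y \<epsilon>) T) \<and>
    x 0 0 = x\<^sub>0 \<and> y 0 0 = y\<^sub>0 \<and>
    ((\<lambda>\<epsilon>. (x \<epsilon> 0, y \<epsilon> 0)) \<longlongrightarrow> (x\<^sub>0, y\<^sub>0)) (at 0) \<and>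
    uniform_limit UNIV
      (\<lambda>\<epsilon> t. (x \<epsilon> t, y \<epsilon> t))
      (\<lambda>t. ((\<omega> * x\<^sub>0 * cos (\<omega> * t) + y\<^sub>0 * sin (\<omega> * t)) / \<omega>,
            - \<omega> * x\<^sub>0 * sin (\<omega> * t) + y\<^sub>0 * cos (\<omega> * t)))
      (at 0)"
proof -
  \<comment> \<open>The averaged equation is \<open>\<beta> = 3 \<alpha> / 4 \<bar>c\<bar>\<^sup>2 c\<close>.  Its solution is a real multiple \<open>m\<close> of \<open>\<beta>\<close>,
    which explains the cube roots.\<close>
  define \<beta> where "\<beta> = Complex (a 1) (b 1)"
  define R where "R = a 1 ^ 2 + b 1 ^ 2"
  define m where "m = root 3 (4 / (3 * \<alpha> * R))"
  define c where "c = of_real m * \<beta>"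
  have T: "0 < T" using \<open>\<omega> > 0\<close> \<open>T = 2 * pi / \<omega>\<close> by simp
  interpret f: periodic_fun_simple f T by fact
  have R: "R \<noteq> 0" and \<beta>: "\<beta> \<noteq> 0"
    using \<open>a 1 \<noteq> 0 \<or> b 1 \<noteq> 0\<close> by (auto simp: R_def \<beta>_def complex_eq_iff sum_power2_eq_zero_iff)
  have m3: "m ^ 3 = 4 / (3 * \<alpha> * R)" by (simp add: m_def odd_real_root_pow)
  then have "m \<noteq> 0" using \<open>\<alpha> \<noteq> 0\<close> R by auto
  then have c: "c \<noteq> 0" using \<beta> by (simp add: c_def)
  have cube_root: "root 3 (4 / (3 * \<alpha> * R) * s ^ 3) = m * s" for s
    by (subst real_root_mult) (simp add: m_def odd_real_root_power_cancel)
  have x0: "Re c = x\<^sub>0"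
    using cube_root[of "a 1"] assms(10) by (simp add: R_def c_def \<beta>_def)
  have y0: "\<omega> * Im c = y\<^sub>0"
    using cube_root[of "b 1 * \<omega>"] assms(11) by (simp add: R_def c_def \<beta>_def power_mult_distrib mult_ac)
  have "c\<^sup>2 * cnj c = of_real (m ^ 3) * (\<beta> * cnj \<beta>) * \<beta>"
    by (simp add: c_def power2_eq_square power3_eq_cube)
  also have "\<beta> * cnj \<beta> = of_real R" by (simp add: complex_mult_cnj \<beta>_def R_def)
  also have "of_real (m ^ 3) * complex_of_real R = of_real (4 / (3 * \<alpha>))"
    unfolding of_real_mult[symmetric] m3 using R by simp
  finally have c_cubic: "c\<^sup>2 * cnj c = of_real (4 / (3 * \<alpha>)) * \<beta>" .

  obtain B where B: "0 \<le> B" "\<And>t. norm (f t) \<le> B"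
    using periodic_bounded[where f=f, OF T f.plus_1] \<open>dirichlet_conditions T f\<close>
    unfolding dirichlet_conditions_def by metis
  define D where "D = {t. \<not> isCont f t}"
  have fin: "finite (D \<inter> {p..q})" for p q
    using \<open>dirichlet_conditions T f\<close> unfolding dirichlet_conditions_def D_def
    by (intro periodic_discontinuities_locally_finite[where f=f, OF T f.plus_1]) auto
  have int: "(\<lambda>t. f t * g t) integrable_on {0..T}" if "\<And>t. isCont g t" "\<And>t. \<bar>g t\<bar> \<le> 1" for g
  proof (rule integrable_bounded_finite_discontinuities[OF fin])
    show "isCont (\<lambda>t. f t * g t) t" if "t \<notin> D" for t
      using that \<open>\<And>t. isCont g t\<close> by (auto simp: D_def)
    show "norm (f t * g t) \<le> B" for t
      using mult_mono[OF B(2)[of t] \<open>\<And>t. \<bar>g t\<bar> \<le> 1\<close>[of t]] B(1) by (simp add: abs_mult)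
  qed

  \<comment> \<open>\<open>h\<close> is the averaged field; a Newton corrector for it comes from one for the cubic term.\<close>
  define \<kappa> where "\<kappa> = \<i> * of_real T / (2 * of_real \<omega>)"
  define \<gamma> where "\<gamma> = complex_of_real (3 * \<alpha> / 4)"
  define h where "h u = \<kappa> * (\<beta> - \<gamma> * (u\<^sup>2 * cnj u))" for u
  have \<kappa>\<gamma>: "\<kappa> * \<gamma> \<noteq> 0"
    using T \<open>\<omega> > 0\<close> \<open>\<alpha> \<noteq> 0\<close> by (simp add: \<kappa>_def \<gamma>_def)
  have average: "h u = integral {0..T} (\<lambda>t. rotating_field \<omega> \<alpha> f t u)" for u
    using rotating_field_average[OF \<open>\<omega> > 0\<close> \<open>T = 2 * pi / \<omega>\<close> int int, of \<alpha> u]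
    by (simp add: h_def \<kappa>_def \<gamma>_def \<beta>_def assms(7,8))
  obtain Q where Q: "bounded_linear Q" "\<And>w. Q w = 0 \<Longrightarrow> w = 0"
    "\<And>u v. u \<in> cball c (norm c / 18) \<Longrightarrow> v \<in> cball c (norm c / 18) \<Longrightarrow>
      norm (u - v - Q (u\<^sup>2 * cnj u - v\<^sup>2 * cnj v)) \<le> 1 / 2 * norm (u - v)"
    using cubic_newton[OF c] by blast
  define N where "N w = Q (- (w / (\<kappa> * \<gamma>)))" for w
  define K where "K = norm c + norm c / 18"
  have K: "norm u \<le> K" if "u \<in> cball c (norm c / 18)" for u
    using norm_triangle_ineq2[of u c] that by (simp add: K_def dist_norm norm_minus_commute)
  have K0: "0 \<le> K" by (simp add: K_def)

  have "\<exists>\<epsilon>\<^sub>0>0. \<exists>C. \<forall>\<epsilon>. \<bar>\<epsilon>\<bar> < \<epsilon>\<^sub>0 \<longrightarrow>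
    (\<exists>u. continuous_on UNIV u \<and> (\<forall>t. u (t + T) = u t) \<and>
      (\<forall>t. t \<notin> D \<longrightarrow> (u has_vector_derivative \<epsilon> *\<^sub>R rotating_field \<omega> \<alpha> f t (u t)) (at t)) \<and>
      (\<forall>t. norm (u t - c) \<le> C * \<bar>\<epsilon>\<bar>))"
  proof (rule periodic_averaging[OF average T _ _ fin])
    show "0 < norm c / 18" using c by simp
    have "cis (\<omega> * t + 2 * pi) = cis (\<omega> * t)" "cos (\<omega> * t + 2 * pi) = cos (\<omega> * t)"
      "cis (- (\<omega> * t) - 2 * pi) = cis (- (\<omega> * t))" for t
      by (simp flip: cis_mult, simp, simp flip: cis_divide)
    moreover have "\<omega> * (t + T) = \<omega> * t + 2 * pi" for t
      using \<open>\<omega> > 0\<close> \<open>T = 2 * pi / \<omega>\<close> by (simp add: distrib_left)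
    ultimately show "rotating_field \<omega> \<alpha> f (t + T) u = rotating_field \<omega> \<alpha> f t u" for t u
      by (simp add: rotating_field_def f.plus_1)
    show "isCont (\<lambda>s. rotating_field \<omega> \<alpha> f s (v s)) t" if "t \<notin> D" "isCont v t" for v t
      using that by (intro isCont_rotating_field) (auto simp: D_def)
    show "norm (rotating_field \<omega> \<alpha> f t u) \<le> (B + \<bar>\<alpha>\<bar> * K ^ 3 + K) / \<omega>"
      if "u \<in> cball c (norm c / 18)" for t u
      using B(2)[of t] by (intro rotating_field_bound \<open>\<omega> > 0\<close> K that) simp
    show "norm (rotating_field \<omega> \<alpha> f t u - rotating_field \<omega> \<alpha> f t v)
        \<le> (3 * \<bar>\<alpha>\<bar> * K\<^sup>2 + 1) / \<omega> * norm (u - v)"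
      if "u \<in> cball c (norm c / 18)" "v \<in> cball c (norm c / 18)" for t u v
      using rotating_field_diff(1)[OF \<open>\<omega> > 0\<close>, of u K v 0] K that by simp
    show "norm ((rotating_field \<omega> \<alpha> f t (u + w) - rotating_field \<omega> \<alpha> f t u) -
        (rotating_field \<omega> \<alpha> f t (v + w) - rotating_field \<omega> \<alpha> f t v))
        \<le> 6 * \<bar>\<alpha>\<bar> * K / \<omega> * norm w * norm (u - v)"
      if "u \<in> cball c (norm c / 18)" "v \<in> cball c (norm c / 18)"
        "u + w \<in> cball c (norm c / 18)" "v + w \<in> cball c (norm c / 18)" for t u v w
      by (intro rotating_field_diff(2) \<open>\<omega> > 0\<close> K that)
    show "0 \<le> (3 * \<bar>\<alpha>\<bar> * K\<^sup>2 + 1) / \<omega>" "0 \<le> 6 * \<bar>\<alpha>\<bar> * K / \<omega>" "0 \<le> (B + \<bar>\<alpha>\<bar> * K ^ 3 + K) / \<omega>"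
      using \<open>\<omega> > 0\<close> K0 B(1) by auto
    show "h c = 0" using \<open>\<alpha> \<noteq> 0\<close> by (simp add: h_def c_cubic \<gamma>_def)
    show "bounded_linear N"
      unfolding N_def by (intro bounded_linear_compose[OF Q(1)] bounded_linear_minus
          bounded_linear_compose[OF bounded_linear_divide] bounded_linear_ident)
    show "w = 0" if "N w = 0" for w
      using Q(2)[of "- (w / (\<kappa> * \<gamma>))"] that \<kappa>\<gamma> by (simp add: N_def)
    show "norm (u - v - N (h u - h v)) \<le> 1 / 2 * norm (u - v)"
      if "u \<in> cball c (norm c / 18)" "v \<in> cball c (norm c / 18)" for u v
    proof -
      have "h u - h v = - (\<kappa> * \<gamma> * (u\<^sup>2 * cnj u - v\<^sup>2 * cnj v))"
        by (simp add: h_def algebra_simps)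
      then have "N (h u - h v) = Q (u\<^sup>2 * cnj u - v\<^sup>2 * cnj v)"
        unfolding N_def using \<kappa>\<gamma> by simp
      then show ?thesis using Q(3)[OF that] by simp
    qed
  qed auto
  then obtain \<epsilon>\<^sub>0 C u where \<epsilon>\<^sub>0: "0 < \<epsilon>\<^sub>0" and u: "\<And>\<epsilon>. \<bar>\<epsilon>\<bar> < \<epsilon>\<^sub>0 \<Longrightarrow> continuous_on UNIV (u \<epsilon>)"
    "\<And>\<epsilon> t. \<bar>\<epsilon>\<bar> < \<epsilon>\<^sub>0 \<Longrightarrow> u \<epsilon> (t + T) = u \<epsilon> t"
    "\<And>\<epsilon> t. \<bar>\<epsilon>\<bar> < \<epsilon>\<^sub>0 \<Longrightarrow> t \<notin> D \<Longrightarrow>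
      (u \<epsilon> has_vector_derivative \<epsilon> *\<^sub>R rotating_field \<omega> \<alpha> f t (u \<epsilon> t)) (at t)"
    "\<And>\<epsilon> t. \<bar>\<epsilon>\<bar> < \<epsilon>\<^sub>0 \<Longrightarrow> norm (u \<epsilon> t - c) \<le> C * \<bar>\<epsilon>\<bar>"
    by metis

  define z where "z \<epsilon> t = u \<epsilon> t * cis (- (\<omega> * t))" for \<epsilon> t
  define x where "x \<epsilon> t = Re (z \<epsilon> t)" for \<epsilon> t
  define y where "y \<epsilon> t = \<omega> * Im (z \<epsilon> t)" for \<epsilon> t
  have z_limit: "((\<omega> * x\<^sub>0 * cos (\<omega> * t) + y\<^sub>0 * sin (\<omega> * t)) / \<omega>, - \<omega> * x\<^sub>0 * sin (\<omega> * t) + y\<^sub>0 * cos (\<omega> * t))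
      = (Re (c * cis (- (\<omega> * t))), \<omega> * Im (c * cis (- (\<omega> * t))))" for t
    using \<open>\<omega> > 0\<close> unfolding x0[symmetric] y0[symmetric] by (simp add: field_simps)
  have z_close: "norm (z \<epsilon> t - c * cis (- (\<omega> * t))) \<le> C * \<bar>\<epsilon>\<bar>" if "\<bar>\<epsilon>\<bar> < \<epsilon>\<^sub>0" for \<epsilon> t
    using u(4)[OF that, of t] by (simp add: z_def norm_mult flip: left_diff_distrib)
  have unif: "uniform_limit UNIV (\<lambda>\<epsilon> t. (x \<epsilon> t, y \<epsilon> t))
      (\<lambda>t. (Re (c * cis (- (\<omega> * t))), \<omega> * Im (c * cis (- (\<omega> * t))))) (at 0)"
  proof (rule uniform_limitI)
    fix e :: real assume "0 < e"
    then have "\<forall>\<^sub>F \<epsilon> in nhds 0. \<bar>\<epsilon>\<bar> * ((1 + \<omega>) * C) < e \<and> \<bar>\<epsilon>\<bar> * 1 < \<epsilon>\<^sub>0"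
      using \<epsilon>\<^sub>0 by (intro eventually_conj eventually_mult_abs_less)
    then have "\<forall>\<^sub>F \<epsilon> in at 0. \<bar>\<epsilon>\<bar> * ((1 + \<omega>) * C) < e \<and> \<bar>\<epsilon>\<bar> * 1 < \<epsilon>\<^sub>0"
      by (simp add: eventually_nhds_conv_at)
    then show "\<forall>\<^sub>F \<epsilon> in at 0. \<forall>t\<in>UNIV. dist (x \<epsilon> t, y \<epsilon> t)
        (Re (c * cis (- (\<omega> * t))), \<omega> * Im (c * cis (- (\<omega> * t)))) < e"
    proof (eventually_elim, safe)
      fix \<epsilon> t assume \<epsilon>: "\<bar>\<epsilon>\<bar> * ((1 + \<omega>) * C) < e" "\<bar>\<epsilon>\<bar> * 1 < \<epsilon>\<^sub>0"
      let ?d = "z \<epsilon> t - c * cis (- (\<omega> * t))"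
      have "dist (x \<epsilon> t, y \<epsilon> t) (Re (c * cis (- (\<omega> * t))), \<omega> * Im (c * cis (- (\<omega> * t))))
          = norm (Re ?d, \<omega> * Im ?d)"
        by (simp add: dist_norm x_def y_def algebra_simps)
      also have "\<dots> \<le> \<bar>Re ?d\<bar> + \<omega> * \<bar>Im ?d\<bar>"
        using norm_Pair_le[of "Re ?d" "\<omega> * Im ?d"] \<open>\<omega> > 0\<close> by (simp only: real_norm_def abs_mult)
      also have "\<dots> \<le> norm ?d + \<omega> * norm ?d"
        using \<open>\<omega> > 0\<close> by (intro add_mono mult_left_mono abs_Re_le_cmod abs_Im_le_cmod) simp
      also have "\<dots> = (1 + \<omega>) * norm ?d" by (simp add: distrib_right)
      also have "\<dots> \<le> (1 + \<omega>) * (C * \<bar>\<epsilon>\<bar>)"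
        using z_close[of \<epsilon> t] \<epsilon> \<open>\<omega> > 0\<close> by (intro mult_left_mono) auto
      also have "\<dots> < e" using \<epsilon>(1) by (simp add: mult_ac)
      finally show "dist (x \<epsilon> t, y \<epsilon> t) (Re (c * cis (- (\<omega> * t))), \<omega> * Im (c * cis (- (\<omega> * t)))) < e" .
    qed
  qed

  show ?thesis
  proof (rule exI[of _ \<epsilon>\<^sub>0], intro conjI \<epsilon>\<^sub>0, rule exI[of _ x], rule exI[of _ y], intro conjI allI impI)
    fix \<epsilon> assume \<epsilon>: "\<bar>\<epsilon>\<bar> < \<epsilon>\<^sub>0"
    show "forced_osc_solution \<omega> \<alpha> f \<epsilon> (x \<epsilon>) (y \<epsilon>)"
      unfolding x_def[abs_def] y_def[abs_def] z_def
      using fin u(3)[OF \<epsilon>] by (intro forced_osc_solution_from_rotating \<open>\<omega> > 0\<close> u(1)[OF \<epsilon>]) (auto simp: D_def)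
    have "cis (- (\<omega> * (t + T))) = cis (- (\<omega> * t))" for t
    proof -
      have "- (\<omega> * (t + T)) = - (\<omega> * t) - 2 * pi"
        using \<open>\<omega> > 0\<close> \<open>T = 2 * pi / \<omega>\<close> by (simp add: distrib_left)
      then show ?thesis by (simp flip: cis_divide)
    qed
    then have "z \<epsilon> (t + T) = z \<epsilon> t" for t
      using u(2)[OF \<epsilon>] by (simp add: z_def)
    then show "periodic_fun_simple (x \<epsilon>) T" "periodic_fun_simple (y \<epsilon>) T"
      by (auto simp: periodic_fun_simple_def x_def y_def)
  next
    \<comment> \<open>The estimate \<open>C * \<bar>\<epsilon>\<bar>\<close> is zero for \<open>\<epsilon> = 0\<close>, so it fixes the unperturbed solution.\<close>
    have "z 0 0 = c" using z_close[of 0 0] \<epsilon>\<^sub>0 by simp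
    then show "x 0 0 = x\<^sub>0" "y 0 0 = y\<^sub>0" using x0 y0 by (simp_all add: x_def y_def)
  next
    show "((\<lambda>\<epsilon>. (x \<epsilon> 0, y \<epsilon> 0)) \<longlongrightarrow> (x\<^sub>0, y\<^sub>0)) (at 0)"
      using tendsto_uniform_limitI[OF unif, of 0] by (simp add: x0 y0)
  next
    show "uniform_limit UNIV (\<lambda>\<epsilon> t. (x \<epsilon> t, y \<epsilon> t))
      (\<lambda>t. ((\<omega> * x\<^sub>0 * cos (\<omega> * t) + y\<^sub>0 * sin (\<omega> * t)) / \<omega>,
            - \<omega> * x\<^sub>0 * sin (\<omega> * t) + y\<^sub>0 * cos (\<omega> * t))) (at 0)"
      unfolding z_limit by (rule unif)
  qed
qed

end
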